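(* Let $n=2$, let $\mathbf A\in L(\mathbb R^2)$ be an orthogonal operator with $\mathbf A^m=\mathbf I$ for some positive integer $m$, and let $X(t)$, $X^*(t)$, $t\ge0$, be the solutions of $D_HX(t)=\mathbf AX(t)$ with initial conditions $X(0)=X_0\in\mathfrak C$, $X^*(0)=X_0^*\in\mathfrak C$. Then, for all $t\ge0$: if $m\ge3$ is odd, $$\begin{aligned}S[X(t),X^*(t)]={}&\frac1m\Big(e^{2t}+2\sum_{q=1}^{[m/2]}e^{2t\cos\frac{2\pi q}{m}}\Big)S[X_0,X_0^*]\\&+\frac1{m^2}\sum_{p=1}^{m-1}\Big((m-p)e^{2t}+2\sum_{q=1}^{[m/2]}\Big[(m-p)\cos\frac{2\pi pq}{m}+2t\sin\frac{2\pi pq}{m}\sin\frac{2\pi q}{m}\Big]e^{2t\cos\frac{2\pi q}{m}}\Big)\\&\qquad\times\big(S[X_0,\mathbf A^pX_0^*]+S[X_0^*,\mathbf A^pX_0]\big);\end{aligned}$$ if $m\ge4$ is even, $$\begin{aligned}S[X(t),X^*(t)]={}&\frac1m\Big(e^{2t}+e^{-2t}+2\sum_{q=1}^{(m-2)/2}e^{2t\cos\frac{2\pi q}{m}}\Big)S[X_0,X_0^*]\\&+\frac1{m^2}\sum_{p=1}^{m-1}\Big((m-p)\big(e^{2t}+(-1)^pe^{-2t}\big)+2\sum_{q=1}^{(m-2)/2}\Big[(m-p)\cos\frac{2\pi pq}{m}+2t\sin\frac{2\pi pq}{m}\sin\frac{2\pi q}{m}\Big]e^{2t\cos\frac{2\pi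 q}{m}}\Big)\\&\qquad\times\big(S[X_0,\mathbf A^pX_0^*]+S[X_0^*,\mathbf A^pX_0]\big).\end{aligned}$$
   Context: $\operatorname{conv}\mathbb R^2$ is the space of nonempty convex compact subsets of $\mathbb R^2$ with the Hausdorff metric $d_H$. $\mathfrak C=\{X\in\operatorname{conv}\mathbb R^2:\operatorname{int}X\neq\emptyset\}$. $\mathbf AX=\{\mathbf Ax:x\in X\}$; sums of sets are Minkowski sums. $S[X,Y]$ is the Minkowski mixed area of $X,Y\in\operatorname{conv}\mathbb R^2$, normalized so that $S[X,X]$ is the area of $X$. $[m/2]$ denotes the integer part. Hukuhara derivative: for $X,Y\in\operatorname{conv}\mathbb R^2$, the Hukuhara difference $X\ominus Y$ is the set $Z\in\operatorname{conv}\mathbb R^2$ with $X=Y+Z$, if it exists. $D_HX(t)$ is the element of $\operatorname{conv}\mathbb R^2$ that is the common $d_H$-limit, as $h\to0^+$, of $h^{-1}(X(t+h)\ominus X(t))$ and $h^{-1}(X(t)\ominus X(t-h))$ (only the first at $t=0$). The Cauchy problem $D_HX=\mathbf AX$, $X(0)=X_0$, has a unique solution on $[0,\infty)$, equivalently $X(t)=X_0+\int_0^t\mathbf AX(s)\,ds$ (set-valued integral). *)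

theory Defs
  imports "HOL-Analysis.Analysis"
begin

definition conv_space :: "'a::euclidean_space set set" where
  "conv_space = {X. X \<noteq> {} \<and> convex X \<and> compact X}"

definition convex_bodies :: "'a::euclidean_space set set" where
  "convex_bodies = {X \<in> conv_space. interior X \<noteq> {}}"

(* All uses are on nonempty compact sets, where both suprema are bounded. *)
definition hausdorff_dist :: "'a::metric_space set \<Rightarrow> 'a set \<Rightarrow> real" where
  "hausdorff_dist X Y = max (SUP x\<in>X. infdist x Y) (SUP y\<in>Y. infdist y X)"

definition is_hukuhara_diff :: "'a::euclidean_space set \<Rightarrow> 'a set \<Rightarrow> 'a set \<Rightarrow> bool" where
  "is_hukuhara_diff X Y Z \<longleftrightarrow> Z \<in> conv_space \<and> X = Y + Z"

(* Z is unique for X, Y in conv_space, by the cancellation law for Minkowski sums. *)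
definition hukuhara_diff :: "'a::euclidean_space set \<Rightarrow> 'a set \<Rightarrow> 'a set" (infixl "\<ominus>\<^sub>H" 65) where
  "X \<ominus>\<^sub>H Y = (THE Z. is_hukuhara_diff X Y Z)"

(* The eventuality clauses say that the difference quotients exist for all small h > 0. *)
definition has_hukuhara_derivative ::
    "(real \<Rightarrow> 'a::euclidean_space set) \<Rightarrow> 'a set \<Rightarrow> real \<Rightarrow> bool" where
  "has_hukuhara_derivative X D t \<longleftrightarrow>
     D \<in> conv_space \<and>
     (\<forall>\<^sub>F h in at_right 0. \<exists>Z. is_hukuhara_diff (X (t + h)) (X t) Z) \<and>
     ((\<lambda>h. hausdorff_dist ((*\<^sub>R) (inverse h) ` (X (t + h) \<ominus>\<^sub>H X t)) D) \<longlongrightarrow> 0) (at_right 0) \<and>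
     (t > 0 \<longrightarrow>
       (\<forall>\<^sub>F h in at_right 0. \<exists>Z. is_hukuhara_diff (X t) (X (t - h)) Z) \<and>
       ((\<lambda>h. hausdorff_dist ((*\<^sub>R) (inverse h) ` (X t \<ominus>\<^sub>H X (t - h))) D) \<longlongrightarrow> 0) (at_right 0))"

definition hukuhara_solution ::
    "('a::euclidean_space \<Rightarrow> 'a) \<Rightarrow> 'a set \<Rightarrow> (real \<Rightarrow> 'a set) \<Rightarrow> bool" where
  "hukuhara_solution A X0 X \<longleftrightarrow>
     X 0 = X0 \<and> (\<forall>t\<ge>0. X t \<in> conv_space \<and> has_hukuhara_derivative X (A ` X t) t)"

(* Minkowski's definition: half the coefficient of a * b in the quadratic form
   giving the area of a X + b Y. *)
definition mixed_area :: "(real^2) set \<Rightarrow> (real^2) set \<Rightarrow> real" where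
  "mixed_area X Y =
     (THE s. \<forall>a\<ge>0. \<forall>b\<ge>0. measure lebesgue ((*\<^sub>R) a ` X + (*\<^sub>R) b ` Y) =
        a\<^sup>2 * measure lebesgue X + 2 * a * b * s + b\<^sup>2 * measure lebesgue Y)"

lemma mixed_area_self:
  assumes "X \<in> conv_space"
  shows "mixed_area X X = measure lebesgue X"
proof -
  have cv: "convex X" using assms by (simp add: conv_space_def)
  have sum: "(*\<^sub>R) a ` X + (*\<^sub>R) b ` X = (*\<^sub>R) (a + b) ` X" if ab: "a \<ge> 0" "b \<ge> 0" for a b :: real
  proof (cases "a + b = 0")
    case True
    then have "a = 0" "b = 0" using ab by auto
    then show ?thesis by (auto simp: set_plus_def)
  next
    case False
    then have pos: "a + b > 0" using ab by auto
    show ?thesis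
    proof (intro set_eqI iffI)
      fix z assume "z \<in> (*\<^sub>R) a ` X + (*\<^sub>R) b ` X"
      then obtain x y where xy: "x \<in> X" "y \<in> X" and z: "z = a *\<^sub>R x + b *\<^sub>R y"
        by (auto simp: set_plus_def)
      have "(a/(a+b)) *\<^sub>R x + (b/(a+b)) *\<^sub>R y \<in> X"
        using cv xy ab pos by (intro convexD) (auto simp: add_divide_distrib[symmetric])
      moreover have "z = (a+b) *\<^sub>R ((a/(a+b)) *\<^sub>R x + (b/(a+b)) *\<^sub>R y)"
        using pos unfolding z by (simp add: scaleR_right_distrib)
      ultimately show "z \<in> (*\<^sub>R) (a + b) ` X" by blast
    next
      fix z assume "z \<in> (*\<^sub>R) (a + b) ` X"
      then show "z \<in> (*\<^sub>R) a ` X + (*\<^sub>R) b ` X"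
        by (auto simp: set_plus_def scaleR_left_distrib)
    qed
  qed
  have "measure lebesgue ((*\<^sub>R) c ` X) = c\<^sup>2 * measure lebesgue X" if "c \<ge> 0" for c :: real
  proof -
    have "(*\<^sub>R) c ` X = (\<lambda>x. c *\<^sub>R x + 0) ` X" by simp
    then show ?thesis
      using measure_lebesgue_affine[of c 0 X] by simp
  qed
  then have meas: "measure lebesgue ((*\<^sub>R) a ` X + (*\<^sub>R) b ` X) = (a+b)\<^sup>2 * measure lebesgue X"
    if "a \<ge> 0" "b \<ge> 0" for a b :: real
    using sum[OF that] that by simp
  show ?thesis
    unfolding mixed_area_def
  proof (rule the_equality)
    show "\<forall>a\<ge>0. \<forall>b\<ge>0. measure lebesgue ((*\<^sub>R) a ` X + (*\<^sub>R) b ` X) =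
        a\<^sup>2 * measure lebesgue X + 2 * a * b * measure lebesgue X + b\<^sup>2 * measure lebesgue X"
      using meas by (simp add: power2_eq_square algebra_simps)
  next
    fix s assume "\<forall>a\<ge>0. \<forall>b\<ge>0. measure lebesgue ((*\<^sub>R) a ` X + (*\<^sub>R) b ` X) =
        a\<^sup>2 * measure lebesgue X + 2 * a * b * s + b\<^sup>2 * measure lebesgue X"
    from this[rule_format, of 1 1] meas[of 1 1] show "s = measure lebesgue X"
      by simp
  qed
qed

end

theory Submission
  imports Defs
begin

text \<open>
  The support function turns Minkowski sums into sums, so along a solution the functions
  \<open>f\<^sub>j(t) = h(A\<^sup>j X(t), u)\<close> satisfy the cyclic linear system \<open>f\<^sub>j' = f\<^sub>j\<^sub>+\<^sub>1\<close>. Hence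
  \<open>h(X(t), \<cdot>)\<close> is a combination of the \<open>h(A\<^sup>j X\<^sub>0, \<cdot>)\<close> with coefficients \<open>c\<^sub>j(t)\<close> given by a
  discrete Fourier sum.

  Area is a quadratic form of the support function: cutting the corners of the circumscribed
  rectangle successively along the supporting lines with normals in the Stern--Brocot tree
  removes from the corner between the normals \<open>a\<close>, \<open>b\<close> a triangle of area
  \<open>(h(a) + h(b) - h(a + b))\<^sup>2 / 2\<close>, and these triangles exhaust the complement of the body.
  So the mixed area is a limit of bilinear forms in the support functions, and
  \<open>S[X(t), X\<^sup>*(t)] = \<Sum>\<^sub>i\<^sub>j c\<^sub>i c\<^sub>j S[A\<^sup>i X\<^sub>0, A\<^sup>j X\<^sub>0\<^sup>*]\<close>. By invariance under \<open>A\<close> only the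
  cyclic autocorrelation of the \<open>c\<^sub>j\<close> enters.
\<close>

section \<open>Support functions and Hukuhara derivatives\<close>

definition support_fun :: "'a::euclidean_space set \<Rightarrow> 'a \<Rightarrow> real" where
  "support_fun K u = (SUP x\<in>K. u \<bullet> x)"

lemma conv_spaceD:
  assumes "K \<in> conv_space"
  shows "K \<noteq> {}" "convex K" "compact K"
  using assms by (auto simp: conv_space_def)

lemma conv_space_plus:
  assumes "K \<in> conv_space" "L \<in> conv_space"
  shows "K + L \<in> conv_space"
proof -
  have "K + L = {x + y |x y. x \<in> K \<and> y \<in> L}" by (auto simp: set_plus_def)
  then have "compact (K + L)" using compact_sums[OF conv_spaceD(3) conv_spaceD(3), OF assms] by simp
  moreover have "convex (K + L)" using assms by (simp add: conv_spaceD convex_set_plus)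
  moreover have "K + L \<noteq> {}" using assms by (auto simp: set_plus_def conv_space_def)
  ultimately show ?thesis by (simp add: conv_space_def)
qed

lemma conv_space_linear_image:
  assumes "K \<in> conv_space" "linear f"
  shows "f ` K \<in> conv_space"
  using assms
  by (auto simp: conv_space_def convex_linear_image linear_continuous_on linear_conv_bounded_linear
      intro: compact_continuous_image)

lemma conv_space_scaleR:
  assumes "K \<in> conv_space"
  shows "(*\<^sub>R) c ` K \<in> conv_space"
  using conv_space_linear_image[OF assms, of "(*\<^sub>R) c"] by (simp add: linear_scaleR)

lemma support_fun_attained:
  assumes "K \<in> conv_space"
  obtains x where "x \<in> K" "support_fun K u = u \<bullet> x" "\<And>y. y \<in> K \<Longrightarrow> u \<bullet> y \<le> u \<bullet> x"
proof -
  have "continuous_on K (\<lambda>x. u \<bullet> x)" by (intro continuous_intros)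
  then obtain x where x: "x \<in> K" "\<And>y. y \<in> K \<Longrightarrow> u \<bullet> y \<le> u \<bullet> x"
    using continuous_attains_sup[OF conv_spaceD(3,1)[OF assms]] by blast
  then have "support_fun K u = u \<bullet> x"
    unfolding support_fun_def by (intro cSup_eq_maximum) auto
  with x that show ?thesis by blast
qed

lemma support_fun_eqI:
  assumes "x \<in> K" "u \<bullet> x = c" "\<And>y. y \<in> K \<Longrightarrow> u \<bullet> y \<le> c"
  shows "support_fun K u = c"
  unfolding support_fun_def using assms by (intro cSup_eq_maximum) auto

lemma support_fun_upper:
  assumes "K \<in> conv_space" "x \<in> K"
  shows "u \<bullet> x \<le> support_fun K u"
  using assms support_fun_attained by metis

lemma support_fun_plus:
  assumes "K \<in> conv_space" "L \<in> conv_space"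
  shows "support_fun (K + L) u = support_fun K u + support_fun L u"
proof -
  obtain x where x: "x \<in> K" "support_fun K u = u \<bullet> x" "\<And>y. y \<in> K \<Longrightarrow> u \<bullet> y \<le> u \<bullet> x"
    using support_fun_attained[OF assms(1)] by metis
  obtain z where z: "z \<in> L" "support_fun L u = u \<bullet> z" "\<And>y. y \<in> L \<Longrightarrow> u \<bullet> y \<le> u \<bullet> z"
    using support_fun_attained[OF assms(2)] by metis
  show ?thesis
    by (rule support_fun_eqI[of "x + z"])
      (use x z in \<open>auto simp: set_plus_def inner_add_right intro!: add_mono\<close>)
qed

lemma support_fun_linear_image:
  fixes f :: "'a::euclidean_space \<Rightarrow> 'a"
  assumes "linear f"
  shows "support_fun (f ` K) u = support_fun K (adjoint f u)"
  unfolding support_fun_def image_image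
  by (simp add: adjoint_works[OF assms] inner_commute)

lemma support_fun_scaleR_image:
  assumes "K \<in> conv_space" "c \<ge> 0"
  shows "support_fun ((*\<^sub>R) c ` K) u = c * support_fun K u"
proof -
  obtain x where x: "x \<in> K" "support_fun K u = u \<bullet> x" "\<And>y. y \<in> K \<Longrightarrow> u \<bullet> y \<le> u \<bullet> x"
    using support_fun_attained[OF assms(1)] by metis
  show ?thesis
    by (rule support_fun_eqI[of "c *\<^sub>R x"]) (use x assms in \<open>auto intro!: mult_left_mono\<close>)
qed

lemma support_fun_scaleR:
  assumes "K \<in> conv_space" "c \<ge> 0"
  shows "support_fun K (c *\<^sub>R u) = c * support_fun K u"
proof -
  obtain x where x: "x \<in> K" "support_fun K u = u \<bullet> x" "\<And>y. y \<in> K \<Longrightarrow> u \<bullet> y \<le> u \<bullet> x"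
    using support_fun_attained[OF assms(1)] by metis
  show ?thesis
    by (rule support_fun_eqI[of x]) (use x assms in \<open>auto intro!: mult_left_mono\<close>)
qed

lemma support_fun_add_le:
  assumes "K \<in> conv_space"
  shows "support_fun K (u + v) \<le> support_fun K u + support_fun K v"
proof -
  obtain x where "x \<in> K" "support_fun K (u + v) = (u + v) \<bullet> x"
    using support_fun_attained[OF assms] by metis
  then show ?thesis
    using support_fun_upper[OF assms, of x] by (auto simp: inner_add_left intro: add_mono)
qed

lemma support_fun_separates:
  assumes "K \<in> conv_space" "x \<notin> K"
  obtains v where "support_fun K v < v \<bullet> x"
proof -
  obtain a b where ab: "a \<bullet> x < b" "\<forall>y\<in>K. b < a \<bullet> y"
    using separating_hyperplane_closed_point[of K x] conv_spaceD[OF assms(1)] assms(2)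
      compact_imp_closed by blast
  \<comment> \<open>\<open>a\<close> separates with \<open>K\<close> on the upper side, so its
    negative is the direction in which \<open>x\<close> exceeds the support function.\<close>
  obtain y where "y \<in> K" "support_fun K (- a) = - a \<bullet> y"
    using support_fun_attained[OF assms(1)] by metis
  then have "support_fun K (- a) < - a \<bullet> x" using ab by force
  then show ?thesis by (rule that)
qed

lemma support_fun_inject:
  assumes "K \<in> conv_space" "L \<in> conv_space" "\<And>u. support_fun K u = support_fun L u"
  shows "K = L"
proof (intro set_eqI iffI)
  fix x assume "x \<in> K"
  show "x \<in> L"
  proof (rule ccontr)
    assume "x \<notin> L"
    then show False
      using support_fun_separates[OF assms(2)] support_fun_upper[OF assms(1) \<open>x \<in> K\<close>] assms(3)
      by (metis not_le)
  qed
next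
  fix x assume "x \<in> L"
  show "x \<in> K"
  proof (rule ccontr)
    assume "x \<notin> K"
    then show False
      using support_fun_separates[OF assms(1)] support_fun_upper[OF assms(2) \<open>x \<in> L\<close>] assms(3)
      by (metis not_le)
  qed
qed

text \<open>Minkowski cancellation: support functions add as real numbers, so that of
  \<open>Y\<close> can be subtracted, and a compact convex set is determined by its support
  function. Any witness therefore replaces the definite description.\<close>

lemma hukuhara_diff_eq:
  assumes "Y \<in> conv_space" "is_hukuhara_diff X Y Z"
  shows "X \<ominus>\<^sub>H Y = Z"
  unfolding hukuhara_diff_def
proof (rule the_equality)
  fix W assume W: "is_hukuhara_diff X Y W"
  have "support_fun W u = support_fun Z u" for u
    using W assms support_fun_plus[of Y W u] support_fun_plus[of Y Z u]
    by (auto simp: is_hukuhara_diff_def)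
  then show "W = Z"
    using W assms by (intro support_fun_inject) (auto simp: is_hukuhara_diff_def)
qed fact

text \<open>A maximiser of \<open>u\<close> over \<open>K\<close> is compared with its nearest point
  in \<open>L\<close>; Cauchy-Schwarz bounds the loss.\<close>

lemma support_fun_le_infdist:
  assumes K: "K \<in> conv_space" and L: "L \<in> conv_space"
  shows "support_fun K u - support_fun L u \<le> norm u * (SUP x\<in>K. infdist x L)"
proof -
  obtain x where x: "x \<in> K" "support_fun K u = u \<bullet> x" 
    using support_fun_attained[OF K] by metis
  obtain y where y: "y \<in> L" "infdist x L = dist x y"
    using infdist_attains_inf[of L x] conv_spaceD[OF L] compact_imp_closed by blast
  \<comment> \<open>Compactness bounds the distances from above, which the conditionally complete
    supremum requires.\<close>
  have "compact ((\<lambda>x. infdist x L) ` K)"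
    using conv_spaceD[OF K] by (intro compact_continuous_image continuous_intros)
  then have "infdist x L \<le> (SUP x\<in>K. infdist x L)"
    using x by (intro cSUP_upper) (auto dest: compact_imp_bounded bounded_imp_bdd_above)
  moreover have "support_fun K u - support_fun L u \<le> u \<bullet> (x - y)"
    using support_fun_upper[OF L \<open>y \<in> L\<close>, of u] x by (simp add: inner_diff_right)
  moreover have "u \<bullet> (x - y) \<le> norm u * dist x y"
    by (simp add: dist_norm norm_cauchy_schwarz)
  ultimately show ?thesis
    using y(2) by (smt (verit) mult_left_mono norm_ge_zero)
qed

lemma support_fun_hausdorff_dist:
  assumes "K \<in> conv_space" "L \<in> conv_space"
  shows "\<bar>support_fun K u - support_fun L u\<bar> \<le> norm u * hausdorff_dist K L"
proof -
  have "norm u * (SUP x\<in>K. infdist x L) \<le> norm u * hausdorff_dist K L"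
    "norm u * (SUP x\<in>L. infdist x K) \<le> norm u * hausdorff_dist K L"
    by (auto simp: hausdorff_dist_def intro: mult_left_mono)
  then show ?thesis
    using support_fun_le_infdist[OF assms, of u] support_fun_le_infdist[OF assms(2,1), of u]
    by linarith
qed

text \<open>The quotient is the support function of the rescaled Hukuhara difference, and Hausdorff
  convergence forces pointwise convergence of support functions. Arbitrary \<open>X h\<close> and
  \<open>Y h\<close> let the lemma serve both forward and backward quotients.\<close>

lemma support_fun_difference_quotient:
  assumes conv: "\<forall>\<^sub>F h in at_right 0. Y h \<in> conv_space" and D: "D \<in> conv_space"
    and ex: "\<forall>\<^sub>F h in at_right 0. \<exists>Z. is_hukuhara_diff (X h) (Y h) Z"
    and lim: "((\<lambda>h. hausdorff_dist ((*\<^sub>R) (inverse h) ` (X h \<ominus>\<^sub>H Y h)) D) \<longlongrightarrow> 0) (at_right 0)"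
  shows "((\<lambda>h. (support_fun (X h) u - support_fun (Y h) u) / h) \<longlongrightarrow> support_fun D u)
    (at_right (0::real))"
proof -
  let ?d = "\<lambda>h. hausdorff_dist ((*\<^sub>R) (inverse h) ` (X h \<ominus>\<^sub>H Y h)) D"
  have "((\<lambda>h. (support_fun (X h) u - support_fun (Y h) u) / h - support_fun D u) \<longlongrightarrow> 0)
    (at_right 0)"
  proof (rule tendsto_0_le[OF lim, of _ "norm u"])
    show "\<forall>\<^sub>F h in at_right 0. norm ((support_fun (X h) u - support_fun (Y h) u) / h
        - support_fun D u) \<le> norm (?d h) * norm u"
      using ex conv eventually_at_right_less[of 0]
    proof eventually_elim
      case (elim h)
      then obtain Z where Z: "is_hukuhara_diff (X h) (Y h) Z" by blast
      then have Zc: "Z \<in> conv_space" "X h = Y h + Z" by (auto simp: is_hukuhara_diff_def)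
      have eq: "X h \<ominus>\<^sub>H Y h = Z" using hukuhara_diff_eq Z elim by blast
      have "(support_fun (X h) u - support_fun (Y h) u) / h
          = support_fun ((*\<^sub>R) (inverse h) ` Z) u"
        using Zc elim support_fun_plus[of "Y h" Z u]
        by (simp add: support_fun_scaleR_image divide_inverse)
      then have "norm ((support_fun (X h) u - support_fun (Y h) u) / h - support_fun D u)
          \<le> norm u * ?d h"
        using support_fun_hausdorff_dist[OF conv_space_scaleR[OF Zc(1)] D] eq by simp
      also have "\<dots> \<le> norm (?d h) * norm u"
        by (simp add: mult.commute mult_left_mono)
      finally show ?case .
    qed
  qed
  then show ?thesis by (simp add: LIM_zero_iff)
qed

text \<open>Forward and backward quotients give the right and left derivative; at
  \<open>t = 0\<close> only the forward one is available, hence the derivative within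
  \<open>{0..}\<close>.\<close>

lemma support_fun_hukuhara_derivative:
  assumes conv: "\<And>s. s \<ge> 0 \<Longrightarrow> X s \<in> conv_space" and t: "t \<ge> 0"
    and der: "has_hukuhara_derivative X D t"
  shows "((\<lambda>s. support_fun (X s) u) has_real_derivative support_fun D u) (at t within {0..})"
proof -
  let ?f = "\<lambda>s. support_fun (X s) u"
  have D: "D \<in> conv_space" using der by (simp add: has_hukuhara_derivative_def)
  have "((\<lambda>h. (?f (t + h) - ?f t) / h) \<longlongrightarrow> support_fun D u) (at_right 0)"
    by (rule support_fun_difference_quotient)
      (use der conv t D in \<open>auto simp: has_hukuhara_derivative_def\<close>)
  then have right: "((\<lambda>s. (?f s - ?f t) / (s - t)) \<longlongrightarrow> support_fun D u) (at_right t)"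
    unfolding at_right_to_0[of t] filterlim_filtermap by (simp add: add.commute)
  show ?thesis
  proof (cases "t = 0")
    case True
    have "at t within {0..} = at_right t"
      using True by (intro at_within_nhd[of _ UNIV]) auto
    then show ?thesis
      using right by (simp add: has_field_derivative_iff)
  next
    \<comment> \<open>For \<open>h < t\<close> the time \<open>t - h\<close> is still nonnegative,
      so \<open>X (t - h)\<close> is known to lie in \<open>conv_space\<close>.\<close>
    case False
    have "\<forall>\<^sub>F h in at_right 0. h < t"
      using False t by (intro eventually_at_right_real[THEN eventually_mono, of 0 t]) auto
    then have "((\<lambda>h. (?f t - ?f (t - h)) / h) \<longlongrightarrow> support_fun D u) (at_right 0)"
      by (intro support_fun_difference_quotient)
        (use der conv t D False in \<open>auto simp: has_hukuhara_derivative_def elim: eventually_mono\<close>)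
    moreover have "(?f t - ?f (t - h)) / h = (?f (t - h) - ?f t) / (- h)" for h
      by (metis minus_diff_eq minus_divide_divide)
    ultimately have "((\<lambda>h. (?f (t - h) - ?f t) / (- h)) \<longlongrightarrow> support_fun D u) (at_right 0)"
      by simp
    then have "((\<lambda>s. (?f s - ?f t) / (s - t)) \<longlongrightarrow> support_fun D u) (at_left t)"
      unfolding filterlim_at_left_to_right at_right_to_0[of "- t"] filterlim_filtermap by simp
    with right have "(?f has_real_derivative support_fun D u) (at t)"
      unfolding has_field_derivative_iff by (simp add: filterlim_at_split)
    then show ?thesis by (rule has_field_derivative_at_within)
  qed
qed

lemma linear_funpow: "linear f \<Longrightarrow> linear (f ^^ n)" for f :: "'a::real_vector \<Rightarrow> 'a"
  by (induction n) (simp_all add: linear_compose linear_id[unfolded id_def] id_def)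

text \<open>Moving \<open>A ^^ j\<close> onto \<open>u\<close> as an adjoint reduces this to the
  derivative of \<open>X\<close> itself; the extra \<open>A\<close> from the equation raises the
  exponent by one.\<close>

lemma support_fun_solution_derivative:
  fixes A :: "'a::euclidean_space \<Rightarrow> 'a"
  assumes sol: "hukuhara_solution A X0 X" and "linear A" "t \<ge> 0"
  shows "((\<lambda>s. support_fun ((A ^^ j) ` X s) u) has_real_derivative
    support_fun ((A ^^ Suc j) ` X t) u) (at t within {0..})"
proof -
  have lin: "linear (A ^^ j)" using assms linear_funpow by blast
  have "((\<lambda>s. support_fun (X s) (adjoint (A ^^ j) u)) has_real_derivative
      support_fun (A ` X t) (adjoint (A ^^ j) u)) (at t within {0..})"
    using assms by (intro support_fun_hukuhara_derivative) (auto simp: hukuhara_solution_def)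
  then show ?thesis
    by (simp add: support_fun_linear_image[OF lin, symmetric] image_comp funpow_Suc_right
        del: funpow.simps)
qed

section \<open>Area as a quadratic form of the support function\<close>

text \<open>Isolates the properties of a support function on which the corner cutting rests, so that
  it can be done without reference to a body.\<close>

locale sublinear =
  fixes h :: "real^2 \<Rightarrow> real"
  assumes add_le: "h (u + v) \<le> h u + h v"
    and scaleR: "c \<ge> 0 \<Longrightarrow> h (c *\<^sub>R u) = c * h u"

text \<open>The corners cut off by the supporting lines with normals in the Stern--Brocot tree
  spanned by \<open>a\<close> and \<open>b\<close>, down to depth \<open>n\<close>.\<close>

fun cut_off :: "(real^2 \<Rightarrow> real) \<Rightarrow> nat \<Rightarrow> real^2 \<Rightarrow> real^2 \<Rightarrow> (real^2) set" where
  "cut_off h 0 a b = {}"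
| "cut_off h (Suc n) a b =
     {x. a \<bullet> x \<le> h a \<and> b \<bullet> x \<le> h b \<and> h (a + b) < (a + b) \<bullet> x}
     \<union> cut_off h n a (a + b) \<union> cut_off h n (a + b) b"

text \<open>Polarised area of \<open>cut_off\<close>: for \<open>h = k\<close> and
  \<open>det2 a b = 1\<close> each summand is the area of one removed triangle. Separate arguments
  make the expression bilinear.\<close>

fun cut_off_form :: "(real^2 \<Rightarrow> real) \<Rightarrow> (real^2 \<Rightarrow> real) \<Rightarrow> nat \<Rightarrow> real^2 \<Rightarrow> real^2 \<Rightarrow> real" where
  "cut_off_form h k 0 a b = 0"
| "cut_off_form h k (Suc n) a b =
     (h a + h b - h (a + b)) * (k a + k b - k (a + b)) / 2
     + cut_off_form h k n a (a + b) + cut_off_form h k n (a + b) b"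

abbreviation det2 :: "real^2 \<Rightarrow> real^2 \<Rightarrow> real" where
  "det2 a b \<equiv> a $ 1 * b $ 2 - a $ 2 * b $ 1"

section \<open>Area of a single cut-off triangle\<close>

lemma inner_real2: "u \<bullet> v = u $ 1 * v $ 1 + u $ 2 * v $ 2" for u v :: "real^2"
  by (simp add: inner_vec_def sum_2)

lemma vec2_eq_iff: "u = v \<longleftrightarrow> u $ 1 = v $ 1 \<and> u $ 2 = v $ 2" for u v :: "real^2"
  by (simp add: vec_eq_iff forall_2)

lemma det2_point:
  assumes "det2 a b = 1"
  obtains x where "a \<bullet> x = \<alpha>" "b \<bullet> x = \<beta>"
proof
  \<comment> \<open>Cramer's rule.\<close>
  let ?x = "vector [b $ 2 * \<alpha> - a $ 2 * \<beta>, a $ 1 * \<beta> - b $ 1 * \<alpha>] :: real^2"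
  have "a \<bullet> ?x = det2 a b * \<alpha>" "b \<bullet> ?x = det2 a b * \<beta>"
    by (simp_all add: inner_real2 algebra_simps)
  then show "a \<bullet> ?x = \<alpha>" "b \<bullet> ?x = \<beta>" using assms by simp_all
qed

lemma det2_inj:
  assumes "det2 a b = 1" "a \<bullet> x = a \<bullet> y" "b \<bullet> x = b \<bullet> y"
  shows "x = y"
proof -
  have "a $ 1 * (x - y) $ 1 + a $ 2 * (x - y) $ 2 = 0" "b $ 1 * (x - y) $ 1 + b $ 2 * (x - y) $ 2 = 0"
    using assms by (simp_all add: inner_real2 algebra_simps)
  then have "det2 a b * (x - y) $ 1 = 0" "det2 a b * (x - y) $ 2 = 0"
    by algebra+
  then show ?thesis using assms(1) by (simp add: vec2_eq_iff)
qed

text \<open>\<open>p\<close>, \<open>q\<close>, \<open>r\<close> are the pairwise intersections of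
  the three boundary lines. The barycentric coordinates of a point are its slacks in the three
  inequalities divided by \<open>\<alpha> + \<beta> - \<gamma>\<close>, the slack of each vertex in
  the inequality of the opposite side.\<close>

lemma closed_corner_eq_hull:
  assumes det: "det2 a b = 1" and "\<gamma> < \<alpha> + \<beta>"
    and p: "a \<bullet> p = \<alpha>" "b \<bullet> p = \<beta>" and q: "a \<bullet> q = \<gamma> - \<beta>" "b \<bullet> q = \<beta>"
    and r: "a \<bullet> r = \<alpha>" "b \<bullet> r = \<gamma> - \<alpha>"
  shows "{x. a \<bullet> x \<le> \<alpha> \<and> b \<bullet> x \<le> \<beta> \<and> \<gamma> \<le> (a + b) \<bullet> x} = convex hull {p, q, r}"
    (is "?T = _")
proof
  have "?T = {x. a \<bullet> x \<le> \<alpha>} \<inter> {x. b \<bullet> x \<le> \<beta>} \<inter> {x. (a + b) \<bullet> x \<ge> \<gamma>}" by auto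
  then have "convex ?T"
    by (auto intro!: convex_Int convex_halfspace_le convex_halfspace_ge)
  moreover have "{p, q, r} \<subseteq> ?T" using assms by (auto simp: inner_add_left)
  ultimately show "convex hull {p, q, r} \<subseteq> ?T" by (rule hull_minimal[rotated])
  show "?T \<subseteq> convex hull {p, q, r}"
  proof
    fix x assume x: "x \<in> ?T"
    define d where "d = \<alpha> + \<beta> - \<gamma>"
    have d: "d > 0" using assms by (simp add: d_def)
    define v w where "v = (\<alpha> - a \<bullet> x) / d" and "w = (\<beta> - b \<bullet> x) / d"
    have vd: "v * d = \<alpha> - a \<bullet> x" and wd: "w * d = \<beta> - b \<bullet> x" using d by (simp_all add: v_def w_def)
    have "(v + w) * d \<le> 1 * d"
      unfolding distrib_right vd wd using x by (simp add: inner_add_left d_def)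
    then have 1: "0 \<le> 1 - v - w" using d by (simp add: mult_le_cancel_right)
    have 0: "0 \<le> v" "0 \<le> w" using x d by (auto simp: v_def w_def)
    have "x = (1 - v - w) *\<^sub>R p + v *\<^sub>R q + w *\<^sub>R r"
    proof (rule det2_inj[OF det])
      have "a \<bullet> ((1 - v - w) *\<^sub>R p + v *\<^sub>R q + w *\<^sub>R r) = \<alpha> - v * d"
        unfolding inner_add_right inner_scaleR_right p q r d_def by (simp add: algebra_simps)
      then show "a \<bullet> x = a \<bullet> ((1 - v - w) *\<^sub>R p + v *\<^sub>R q + w *\<^sub>R r)" by (simp add: vd)
      have "b \<bullet> ((1 - v - w) *\<^sub>R p + v *\<^sub>R q + w *\<^sub>R r) = \<beta> - w * d"
        unfolding inner_add_right inner_scaleR_right p q r d_def by (simp add: algebra_simps)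
      then show "b \<bullet> x = b \<bullet> ((1 - v - w) *\<^sub>R p + v *\<^sub>R q + w *\<^sub>R r)" by (simp add: wd)
    qed
    then show "x \<in> convex hull {p, q, r}"
      unfolding convex_hull_3 using 0 1
      by (intro CollectI exI[of _ "1 - v - w"] exI[of _ v] exI[of _ w]) auto
  qed
qed

text \<open>The map from \<open>x\<close> to the pair of \<open>a \<bullet> x\<close> and
  \<open>b \<bullet> x\<close> has determinant 1 and sends the corner to a right isosceles triangle
  with legs \<open>\<alpha> + \<beta> - \<gamma>\<close>. The proof reads the area off from the
  product rule for determinants.\<close>

lemma measure_corner:
  assumes det: "det2 a b = 1" and le: "\<gamma> \<le> \<alpha> + \<beta>"
  shows "{x. a \<bullet> x \<le> \<alpha> \<and> b \<bullet> x \<le> \<beta> \<and> \<gamma> < (a + b) \<bullet> x} \<in> lmeasurable" (is "?S \<in> _")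
    and "measure lebesgue {x. a \<bullet> x \<le> \<alpha> \<and> b \<bullet> x \<le> \<beta> \<and> \<gamma> < (a + b) \<bullet> x} = (\<alpha> + \<beta> - \<gamma>)\<^sup>2 / 2"
proof -
  have "?S \<in> lmeasurable \<and> measure lebesgue ?S = (\<alpha> + \<beta> - \<gamma>)\<^sup>2 / 2"
  proof (cases "\<gamma> = \<alpha> + \<beta>")
    case True
    then have "?S = {}" by (auto simp: inner_add_left)
    then show ?thesis using True by (simp only:) simp
  next
    case False
    then have less: "\<gamma> < \<alpha> + \<beta>" using le by simp
    obtain p where p: "a \<bullet> p = \<alpha>" "b \<bullet> p = \<beta>" using det2_point[OF det] by blast
    obtain q where q: "a \<bullet> q = \<gamma> - \<beta>" "b \<bullet> q = \<beta>" using det2_point[OF det] by blast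
    obtain r where r: "a \<bullet> r = \<alpha>" "b \<bullet> r = \<gamma> - \<alpha>" using det2_point[OF det] by blast
    let ?T = "{x. a \<bullet> x \<le> \<alpha> \<and> b \<bullet> x \<le> \<beta> \<and> \<gamma> \<le> (a + b) \<bullet> x}"
    have T: "?T = convex hull {p, q, r}" using closed_corner_eq_hull[OF det less p q r] .
    have "?T \<in> lmeasurable" unfolding T by (simp add: lmeasurable_compact compact_convex_hull)
    have "measure lebesgue ?T = \<bar>det2 (r - p) (q - p)\<bar> / 2"
      unfolding T
      by (subst measure_completion, simp add: compact_convex_hull compact_imp_closed)
        (simp add: content_triangle algebra_simps)
    moreover have "det2 a b * det2 (r - p) (q - p)
        = (a \<bullet> (r - p)) * (b \<bullet> (q - p)) - (a \<bullet> (q - p)) * (b \<bullet> (r - p))"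
      by (simp add: inner_real2 algebra_simps)
    then have "det2 (r - p) (q - p) = - ((\<alpha> + \<beta> - \<gamma>)\<^sup>2)"
      unfolding det inner_diff_right p q r by (simp add: power2_eq_square algebra_simps)
    ultimately have T2: "measure lebesgue ?T = (\<alpha> + \<beta> - \<gamma>)\<^sup>2 / 2" by simp
    have "a + b \<noteq> 0"
    proof
      assume "a + b = 0"
      then have "b = - a" by (simp add: eq_neg_iff_add_eq_0 add.commute)
      then show False using det by simp
    qed
    \<comment> \<open>The strict inequality removes one side of the closed triangle, which is a null
      set.\<close>
    then have neg: "negligible {x. (a + b) \<bullet> x = \<gamma>}" by (intro negligible_hyperplane) auto
    have "(?T - ?S) \<union> (?S - ?T) \<subseteq> {x. (a + b) \<bullet> x = \<gamma>}" by auto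
    with neg have "negligible ((?T - ?S) \<union> (?S - ?T))" by (rule negligible_subset)
    with \<open>?T \<in> lmeasurable\<close> T2 show ?thesis
      using measure_negligible_symdiff[of ?T ?S] lmeasurable_negligible_symdiff[of ?T ?S] by simp
  qed
  then show "?S \<in> lmeasurable" "measure lebesgue ?S = (\<alpha> + \<beta> - \<gamma>)\<^sup>2 / 2" by auto
qed

section \<open>Directions violated by a point; disjointness and area of the cut-off pieces\<close>

context sublinear
begin

text \<open>Call \<open>v\<close> violated by \<open>x\<close> if
  \<open>h v < v \<bullet> x\<close>. Sublinearity makes the violated directions a convex cone, and
  the disjointness arguments below rest on this.\<close>

lemma violated_cone:
  assumes "h v < v \<bullet> x" "h w < w \<bullet> x" "c \<ge> 0" "d \<ge> 0" "c + d > 0"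
  shows "h (c *\<^sub>R v + d *\<^sub>R w) < (c *\<^sub>R v + d *\<^sub>R w) \<bullet> x"
proof -
  have "h (c *\<^sub>R v + d *\<^sub>R w) \<le> c * h v + d * h w"
    using add_le[of "c *\<^sub>R v" "d *\<^sub>R w"] assms by (simp add: scaleR)
  also have "\<dots> < c * (v \<bullet> x) + d * (w \<bullet> x)"
  proof (cases "c = 0")
    case True
    then show ?thesis using assms by simp
  next
    case False
    then show ?thesis using assms by (intro add_less_le_mono mult_left_mono) auto
  qed
  finally show ?thesis by (simp add: inner_add_left)
qed

lemma violated_scaleR:
  assumes "c > 0"
  shows "h (c *\<^sub>R v) < (c *\<^sub>R v) \<bullet> x \<longleftrightarrow> h v < v \<bullet> x"
  using assms by (simp add: scaleR)

text \<open>Working form of the cone property: a contradiction arises when a direction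
  \<open>u\<close> known to be satisfied has a positive multiple that combines two violated
  ones.\<close>

lemma violated_between:
  assumes "h v < v \<bullet> x" "h w < w \<bullet> x" "c \<ge> 0" "d \<ge> 0" "c + d > 0"
    "c *\<^sub>R v + d *\<^sub>R w = e *\<^sub>R u" "e > 0"
  shows "h u < u \<bullet> x"
  using violated_cone[OF assms(1-5)] assms(6,7) violated_scaleR by metis

text \<open>Induction down the tree. In the left half, \<open>a + b\<close> is satisfied while
  \<open>p *\<^sub>R a + q *\<^sub>R (a + b)\<close> is violated; were \<open>b\<close> violated
  too, adding \<open>p *\<^sub>R b\<close> would give \<open>(p + q) *\<^sub>R (a + b)\<close>, so
  \<open>a + b\<close> would be violated. The right half is symmetric.\<close>

lemma cut_off_violated:
  assumes "x \<in> cut_off h n a b"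
  shows "a \<bullet> x \<le> h a \<and> b \<bullet> x \<le> h b \<and>
    (\<exists>p>0. \<exists>q>0. h (p *\<^sub>R a + q *\<^sub>R b) < (p *\<^sub>R a + q *\<^sub>R b) \<bullet> x)"
  using assms
proof (induction n arbitrary: a b)
  case 0
  then show ?case by simp
next
  case (Suc n)
  from Suc.prems consider
    "a \<bullet> x \<le> h a" "b \<bullet> x \<le> h b" "h (a + b) < (a + b) \<bullet> x"
    | "x \<in> cut_off h n a (a + b)" | "x \<in> cut_off h n (a + b) b" by auto
  then show ?case
  proof cases
    case 1
    then show ?thesis by (intro conjI exI[of _ 1]) auto
  next
    case 2
    then obtain p q where pq: "p > 0" "q > 0" "h (p *\<^sub>R a + q *\<^sub>R (a + b)) < (p *\<^sub>R a + q *\<^sub>R (a + b)) \<bullet> x"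
      and le: "a \<bullet> x \<le> h a" "(a + b) \<bullet> x \<le> h (a + b)" using Suc.IH by blast
    have "b \<bullet> x \<le> h b"
    proof (rule ccontr)
      assume "\<not> b \<bullet> x \<le> h b"
      then have "h b < b \<bullet> x" by simp
      from violated_between[OF pq(3) this, of 1 p "p + q" "a + b"] pq(1,2) le(2) show False
        by (simp add: algebra_simps)
    qed
    moreover have "p *\<^sub>R a + q *\<^sub>R (a + b) = (p + q) *\<^sub>R a + q *\<^sub>R b" by (simp add: algebra_simps)
    ultimately show ?thesis using pq le by (metis add_pos_pos)
  next
    case 3
    then obtain p q where pq: "p > 0" "q > 0" "h (p *\<^sub>R (a + b) + q *\<^sub>R b) < (p *\<^sub>R (a + b) + q *\<^sub>R b) \<bullet> x"
      and le: "b \<bullet> x \<le> h b" "(a + b) \<bullet> x \<le> h (a + b)" using Suc.IH by blast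
    have "a \<bullet> x \<le> h a"
    proof (rule ccontr)
      assume "\<not> a \<bullet> x \<le> h a"
      then have "h a < a \<bullet> x" by simp
      from violated_between[OF pq(3) this, of 1 q "p + q" "a + b"] pq(1,2) le(2) show False
        by (simp add: algebra_simps)
    qed
    moreover have "p *\<^sub>R (a + b) + q *\<^sub>R b = p *\<^sub>R a + (p + q) *\<^sub>R b" by (simp add: algebra_simps)
    ultimately show ?thesis using pq le by (metis add_pos_pos)
  qed
qed

text \<open>A common point violates one direction strictly between \<open>a\<close> and
  \<open>u\<close> and one strictly between \<open>u\<close> and \<open>b\<close>; these combine to
  a positive multiple of \<open>u\<close>, which is satisfied. The value \<open>e = 1\<close> serves
  the two halves of a corner, \<open>e = 0\<close> neighbouring quadrants with
  \<open>b = - a\<close>.\<close>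

lemma cut_off_adjacent_disjoint:
  assumes "c *\<^sub>R a + d *\<^sub>R b = e *\<^sub>R u" "c > 0" "d > 0" "e \<ge> 0"
  shows "cut_off h n a u \<inter> cut_off h n' u b = {}"
proof (rule ccontr)
  assume "cut_off h n a u \<inter> cut_off h n' u b \<noteq> {}"
  then obtain x where x: "x \<in> cut_off h n a u" "x \<in> cut_off h n' u b" by blast
  obtain p q where pq: "p > 0" "q > 0" "h (p *\<^sub>R a + q *\<^sub>R u) < (p *\<^sub>R a + q *\<^sub>R u) \<bullet> x"
    using cut_off_violated[OF x(1)] by blast
  obtain r s where rs: "r > 0" "s > 0" "h (r *\<^sub>R u + s *\<^sub>R b) < (r *\<^sub>R u + s *\<^sub>R b) \<bullet> x"
    using cut_off_violated[OF x(2)] by blast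
  \<comment> \<open>The weights bring \<open>a\<close> and \<open>b\<close> into the ratio of
    \<open>c\<close> to \<open>d\<close>, so that the hypothesis turns both into a multiple of
    \<open>u\<close>.\<close>
  have "(c * s) *\<^sub>R (p *\<^sub>R a + q *\<^sub>R u) + (d * p) *\<^sub>R (r *\<^sub>R u + s *\<^sub>R b)
      = (p * s) *\<^sub>R (c *\<^sub>R a + d *\<^sub>R b) + (c * s * q + d * p * r) *\<^sub>R u"
    by (simp add: algebra_simps)
  also have "\<dots> = (p * s * e + c * s * q + d * p * r) *\<^sub>R u"
    by (simp add: assms(1) algebra_simps)
  finally have "h u < u \<bullet> x"
  proof (rule violated_between[OF pq(3) rs(3), rotated 3])
    have "0 \<le> p * s * e" "0 < c * s * q" "0 < d * p * r" using assms pq rs by simp_all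
    then show "0 < p * s * e + c * s * q + d * p * r" by linarith
  qed (use assms pq(1,2) rs(1,2) in \<open>simp_all add: add_pos_pos\<close>)
  with cut_off_violated[OF x(1)] show False by simp
qed

text \<open>Passing from \<open>a\<close>, \<open>b\<close> to \<open>a\<close>,
  \<open>a + b\<close> or to \<open>a + b\<close>, \<open>b\<close> keeps the determinant 1, so the
  triangle formula applies at every node and the disjoint pieces add up.\<close>

lemma measure_cut_off:
  assumes "det2 a b = 1"
  shows "cut_off h n a b \<in> lmeasurable \<and>
    measure lebesgue (cut_off h n a b) = cut_off_form h h n a b"
  using assms
proof (induction n arbitrary: a b)
  case 0
  then show ?case by simp
next
  case (Suc n)
  let ?T = "{x. a \<bullet> x \<le> h a \<and> b \<bullet> x \<le> h b \<and> h (a + b) < (a + b) \<bullet> x}"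
  let ?L = "cut_off h n a (a + b)" and ?R = "cut_off h n (a + b) b"
  have T: "?T \<in> lmeasurable" "measure lebesgue ?T = (h a + h b - h (a + b))\<^sup>2 / 2"
    using measure_corner[OF Suc.prems add_le] by auto
  have L: "?L \<in> lmeasurable" "measure lebesgue ?L = cut_off_form h h n a (a + b)"
    using Suc.IH[of a "a + b"] Suc.prems by (auto simp: algebra_simps)
  have R: "?R \<in> lmeasurable" "measure lebesgue ?R = cut_off_form h h n (a + b) b"
    using Suc.IH[of "a + b" b] Suc.prems by (auto simp: algebra_simps)
  \<comment> \<open>Points of the triangle violate \<open>a + b\<close>, whereas both smaller
    corners satisfy it.\<close>
  have "?T \<inter> ?L = {}" "?T \<inter> ?R = {}"
    using cut_off_violated by fastforce+
  moreover have "?L \<inter> ?R = {}"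
    by (rule cut_off_adjacent_disjoint[of 1 _ 1 _ 1]) auto
  ultimately have "measure lebesgue (?T \<union> ?L \<union> ?R)
      = measure lebesgue ?T + measure lebesgue ?L + measure lebesgue ?R"
    using T(1) L(1) R(1) by (intro measure_Un3_negligible) auto
  moreover have "?T \<union> ?L \<union> ?R \<in> lmeasurable"
    by (intro fmeasurable.Un T(1) L(1) R(1))
  ultimately show ?case
    unfolding cut_off.simps cut_off_form.simps T(2) L(2) R(2) power2_eq_square by (rule conjI[rotated])
qed

lemma cut_off_mono: "cut_off h n a b \<subseteq> cut_off h (Suc n) a b"
proof (induction n arbitrary: a b)
  case 0
  then show ?case by simp
next
  case (Suc n)
  show ?case
    using Suc[of a "a + b"] Suc[of "a + b" b] by (subst (1 2) cut_off.simps) blast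
qed

text \<open>The subtractive Euclidean algorithm on \<open>p\<close>, \<open>q\<close>: if
  \<open>a + b\<close> is not yet violated, the violated direction lies in one of the two half
  cones, where its coordinates have a smaller sum. A zero coordinate would make \<open>a\<close> or
  \<open>b\<close> violated.\<close>

lemma violated_imp_cut_off:
  assumes "h (real p *\<^sub>R a + real q *\<^sub>R b) < (real p *\<^sub>R a + real q *\<^sub>R b) \<bullet> x"
    "a \<bullet> x \<le> h a" "b \<bullet> x \<le> h b"
  shows "\<exists>n. x \<in> cut_off h n a b"
  using assms
proof (induction "p + q" arbitrary: p q a b rule: less_induct)
  case less
  have "p \<noteq> 0"
  proof
    assume "p = 0"
    then show False
      using less.prems(1,3) scaleR[of "real q" b] by (simp add: mult_less_cancel_left)
  qed
  moreover have "q \<noteq> 0"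
  proof
    assume "q = 0"
    then show False
      using less.prems(1,2) scaleR[of "real p" a] by (simp add: mult_less_cancel_left)
  qed
  ultimately have pq: "p > 0" "q > 0" by auto
  consider "h (a + b) < (a + b) \<bullet> x" | "(a + b) \<bullet> x \<le> h (a + b)" "q \<le> p"
    | "(a + b) \<bullet> x \<le> h (a + b)" "p \<le> q" by linarith
  then show ?case
  proof cases
    case 1
    then show ?thesis using less.prems by (intro exI[of _ 1]) simp
  next
    case 2
    have "real p *\<^sub>R a + real q *\<^sub>R b = real (p - q) *\<^sub>R a + real q *\<^sub>R (a + b)"
      using 2 by (simp add: algebra_simps of_nat_diff)
    then obtain n where "x \<in> cut_off h n a (a + b)"
      using less.hyps[of "p - q" q a "a + b"] less.prems 2 pq by auto
    then show ?thesis by (intro exI[of _ "Suc n"]) simp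
  next
    case 3
    have "real p *\<^sub>R a + real q *\<^sub>R b = real p *\<^sub>R (a + b) + real (q - p) *\<^sub>R b"
      using 3 by (simp add: algebra_simps of_nat_diff)
    then obtain n where "x \<in> cut_off h n (a + b) b"
      using less.hyps[of p "q - p" "a + b" b] less.prems 3 pq by auto
    then show ?thesis by (intro exI[of _ "Suc n"]) simp
  qed
qed

end

text \<open>The first term polarises the area of the circumscribed rectangle. The four corners are
  listed counterclockwise, so each pair of normals has determinant 1.\<close>

definition area_form :: "(real^2 \<Rightarrow> real) \<Rightarrow> (real^2 \<Rightarrow> real) \<Rightarrow> nat \<Rightarrow> real" where
  "area_form h k n = (let e = axis 1 1; f = axis 2 1 in
     ((h e + h (- e)) * (k f + k (- f)) + (k e + k (- e)) * (h f + h (- f))) / 2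
     - (cut_off_form h k n e f + cut_off_form h k n f (- e)
        + cut_off_form h k n (- e) (- f) + cut_off_form h k n (- f) e))"

context sublinear
begin

lemma zero_not_violated: "\<not> h 0 < 0 \<bullet> x"
  using scaleR[of 0 0] by simp

text \<open>Keeps removed pieces inside the rectangle: if \<open>- a\<close> were violated, adding
  \<open>p\<close> times it to the violated \<open>p *\<^sub>R a + q *\<^sub>R b\<close> would leave
  a violated multiple of \<open>b\<close>.\<close>

lemma cut_off_opposite_side:
  assumes "x \<in> cut_off h n a b"
  shows "- a \<bullet> x \<le> h (- a)" "- b \<bullet> x \<le> h (- b)"
proof -
  obtain p q where pq: "p > 0" "q > 0" "h (p *\<^sub>R a + q *\<^sub>R b) < (p *\<^sub>R a + q *\<^sub>R b) \<bullet> x"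
    and le: "a \<bullet> x \<le> h a" "b \<bullet> x \<le> h b" using cut_off_violated[OF assms] by blast
  show "- a \<bullet> x \<le> h (- a)"
  proof (rule ccontr)
    assume "\<not> - a \<bullet> x \<le> h (- a)"
    then have "h (- a) < - a \<bullet> x" by simp
    from violated_between[OF pq(3) this, of 1 p q b] pq(1,2) le show False by simp
  qed
  show "- b \<bullet> x \<le> h (- b)"
  proof (rule ccontr)
    assume "\<not> - b \<bullet> x \<le> h (- b)"
    then have "h (- b) < - b \<bullet> x" by simp
    from violated_between[OF pq(3) this, of 1 q p a] pq(1,2) le show False by simp
  qed
qed

text \<open>The two violated directions are combined so that \<open>b\<close> cancels. A multiple of
  \<open>a\<close> of unknown sign remains: positive contradicts \<open>a\<close>, negative
  contradicts \<open>- a\<close>, and zero contradicts \<open>h 0 = 0\<close>.\<close>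

lemma cut_off_opposite_disjoint: "cut_off h n a b \<inter> cut_off h n' (- a) (- b) = {}"
proof (rule ccontr)
  assume "cut_off h n a b \<inter> cut_off h n' (- a) (- b) \<noteq> {}"
  then obtain x where x: "x \<in> cut_off h n a b" "x \<in> cut_off h n' (- a) (- b)" by blast
  obtain p q where pq: "p > 0" "q > 0" "h (p *\<^sub>R a + q *\<^sub>R b) < (p *\<^sub>R a + q *\<^sub>R b) \<bullet> x"
    and a: "a \<bullet> x \<le> h a" using cut_off_violated[OF x(1)] by blast
  obtain r s where rs: "r > 0" "s > 0"
    "h (r *\<^sub>R - a + s *\<^sub>R - b) < (r *\<^sub>R - a + s *\<^sub>R - b) \<bullet> x"
    and ma: "- a \<bullet> x \<le> h (- a)" using cut_off_violated[OF x(2)] by blast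
  have eq: "s *\<^sub>R (p *\<^sub>R a + q *\<^sub>R b) + q *\<^sub>R (r *\<^sub>R - a + s *\<^sub>R - b) = (p * s - q * r) *\<^sub>R a"
    by (simp add: algebra_simps)
  consider "p * s - q * r > 0" | "q * r - p * s > 0" | "p * s - q * r = 0" by linarith
  then show False
  proof cases
    case 1
    from violated_between[OF pq(3) rs(3) _ _ _ eq 1] pq(1,2) rs(1,2) a show False by simp
  next
    case 2
    have "(p * s - q * r) *\<^sub>R a = (q * r - p * s) *\<^sub>R - a" by (simp add: algebra_simps)
    from violated_between[OF pq(3) rs(3) _ _ _ trans[OF eq this] 2] pq(1,2) rs(1,2) ma
    show False by simp
  next
    case 3
    from violated_cone[OF pq(3) rs(3), of s q] pq(1,2) rs(1,2) zero_not_violated[of x] show False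
      unfolding eq 3 by simp
  qed
qed

end

section \<open>Exhaustion of the complement of the body in its circumscribed rectangle\<close>

lemma sublinear_support_fun: "K \<in> conv_space \<Longrightarrow> sublinear (support_fun K)"
  by unfold_locales (simp_all add: support_fun_add_le support_fun_scaleR)

lemma support_fun_bound:
  assumes "K \<in> conv_space"
  obtains B where "B > 0" "\<And>u. support_fun K u \<le> B * norm u"
proof -
  obtain B where B: "B > 0" "\<And>x. x \<in> K \<Longrightarrow> norm x \<le> B"
    using conv_spaceD(3)[OF assms] compact_imp_bounded bounded_pos by metis
  have "support_fun K u \<le> B * norm u" for u
  proof -
    obtain x where "x \<in> K" "support_fun K u = u \<bullet> x" using support_fun_attained[OF assms] by metis
    then show ?thesis
      using norm_cauchy_schwarz[of u x] mult_left_mono[OF B(2)[of x], of "norm u"]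
      by (simp add: mult.commute)
  qed
  then show ?thesis by (rule that[OF B(1)])
qed

text \<open>Scaling a real separating direction by \<open>N\<close> makes the gap grow linearly,
  while rounding to integers costs only a bounded amount.\<close>

lemma separating_integer_direction:
  fixes K :: "(real^2) set"
  assumes K: "K \<in> conv_space" and "x \<notin> K"
  obtains i j :: int where
    "support_fun K (vector [of_int i, of_int j]) < vector [of_int i, of_int j] \<bullet> x"
proof -
  obtain v where v: "support_fun K v < v \<bullet> x" using support_fun_separates[OF assms] .
  obtain B where B: "B > 0" "\<And>u. support_fun K u \<le> B * norm u" by (rule support_fun_bound[OF K]) blast
  \<comment> \<open>Total cost of a rounding error of norm at most 2: \<open>2 * B\<close> in the
    support function and \<open>2 * norm x\<close> in the inner product.\<close>
  define M where "M = 2 * (B + norm x)"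
  obtain N :: nat where N: "M < of_nat N * (v \<bullet> x - support_fun K v)"
    using reals_Archimedean3[of "v \<bullet> x - support_fun K v"] v by auto
  define w :: "real^2" where "w = vector [of_int \<lfloor>N * v $ 1\<rfloor>, of_int \<lfloor>N * v $ 2\<rfloor>]"
  define r where "r = w - real N *\<^sub>R v"
  have "norm r \<le> \<bar>r $ 1\<bar> + \<bar>r $ 2\<bar>" using norm_le_l1_cart[of r] by (simp add: sum_2)
  moreover have "\<bar>r $ 1\<bar> \<le> 1" "\<bar>r $ 2\<bar> \<le> 1" unfolding r_def w_def by (simp; linarith)+
  ultimately have r: "norm r \<le> 2" by linarith
  have w: "w = real N *\<^sub>R v + r" by (simp add: r_def)
  have "support_fun K w \<le> N * support_fun K v + support_fun K r"
    using support_fun_add_le[OF K, of "real N *\<^sub>R v" r] support_fun_scaleR[OF K, of N v] w by simp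
  also have "\<dots> \<le> N * support_fun K v + B * 2"
    using B(2)[of r] mult_left_mono[OF r, of B] B(1) by linarith
  also have "\<dots> < N * (v \<bullet> x) - 2 * norm x" using N by (simp add: M_def algebra_simps)
  also have "\<dots> \<le> N * (v \<bullet> x) + r \<bullet> x"
    using Cauchy_Schwarz_ineq2[of r x] mult_right_mono[OF r, of "norm x"] by simp
  also have "\<dots> = w \<bullet> x" by (simp add: w inner_add_left)
  finally show ?thesis using that unfolding w_def by blast
qed

text \<open>Provides natural coefficients over one of the four corners, the form on which the
  Euclidean descent works.\<close>

lemma integer_direction_quadrant:
  fixes i j :: int
  obtains a b p q where "(a, b) \<in> {(axis 1 1, axis 2 1), (axis 2 1, - axis 1 1),
      (- axis 1 1, - axis 2 1), (- axis 2 1, axis 1 1 :: real^2)}"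
    "vector [of_int i, of_int j] = real p *\<^sub>R a + real q *\<^sub>R b"
proof -
  let ?v = "vector [of_int i, of_int j] :: real^2"
  have ax: "axis 1 (1::real) $ (1::2) = 1" "axis 1 (1::real) $ (2::2) = 0"
    "axis 2 (1::real) $ (1::2) = 0" "axis 2 (1::real) $ (2::2) = 1"
    by (simp_all add: axis_def)
  consider "0 \<le> i" "0 \<le> j" | "i \<le> 0" "0 \<le> j" | "i \<le> 0" "j \<le> 0" | "0 \<le> i" "j \<le> 0" by linarith
  then show ?thesis
  proof cases
    case 1
    then have "?v = real (nat i) *\<^sub>R axis 1 1 + real (nat j) *\<^sub>R axis 2 1"
      by (simp add: vec2_eq_iff ax)
    then show ?thesis by (rule that[rotated]) simp
  next
    case 2
    then have "?v = real (nat j) *\<^sub>R axis 2 1 + real (nat (- i)) *\<^sub>R - axis 1 1"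
      by (simp add: vec2_eq_iff ax)
    then show ?thesis by (rule that[rotated]) simp
  next
    case 3
    then have "?v = real (nat (- i)) *\<^sub>R - axis 1 1 + real (nat (- j)) *\<^sub>R - axis 2 1"
      by (simp add: vec2_eq_iff ax)
    then show ?thesis by (rule that[rotated]) simp
  next
    case 4
    then have "?v = real (nat (- j)) *\<^sub>R - axis 2 1 + real (nat i) *\<^sub>R axis 1 1"
      by (simp add: vec2_eq_iff ax)
    then show ?thesis by (rule that[rotated]) simp
  qed
qed

lemma measure_Un4_disjoint:
  assumes "A \<in> fmeasurable M" "B \<in> fmeasurable M" "C \<in> fmeasurable M" "D \<in> fmeasurable M"
    "A \<inter> B = {}" "A \<inter> C = {}" "A \<inter> D = {}" "B \<inter> C = {}" "B \<inter> D = {}" "C \<inter> D = {}"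
  shows "measure M (A \<union> B \<union> C \<union> D) = measure M A + measure M B + measure M C + measure M D"
  using assms by (simp add: measure_Un3 fmeasurable.Un Int_Un_distrib2)

text \<open>The removed sets \<open>C n\<close> increase to \<open>R - K\<close>: each removed point
  violates a supporting half-plane of \<open>K\<close>, and each point of \<open>R - K\<close>
  violates an integer direction, hence is removed at a finite depth. Continuity of measure from
  below concludes.\<close>

lemma area_form_tendsto:
  fixes K :: "(real^2) set"
  assumes K: "K \<in> conv_space"
  shows "area_form (support_fun K) (support_fun K) \<longlonglongrightarrow> measure lebesgue K"
proof -
  define h where "h = support_fun K"
  interpret sublinear h unfolding h_def using sublinear_support_fun[OF K] .
  define e f :: "real^2" where "e = axis 1 1" and "f = axis 2 1"
  have comp: "e $ 1 = 1" "e $ 2 = 0" "f $ 1 = 0" "f $ 2 = 1"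
    by (simp_all add: e_def f_def axis_def)
  define R where "R = cbox (vector [- h (- e), - h (- f)]) (vector [h e, h f] :: real^2)"
  have R_iff: "x \<in> R \<longleftrightarrow> e \<bullet> x \<le> h e \<and> f \<bullet> x \<le> h f \<and> - e \<bullet> x \<le> h (- e) \<and> - f \<bullet> x \<le> h (- f)" for x
    unfolding R_def mem_box_cart forall_2 inner_real2 by (auto simp: comp)
  have KR: "K \<subseteq> R" unfolding R_iff h_def subset_iff using support_fun_upper[OF K] by blast
  then have "R \<noteq> {}" using conv_spaceD(1)[OF K] by blast
  then have "measure lborel R = (h e + h (- e)) * (h f + h (- f))"
    unfolding R_def by (simp add: content_cbox_cart UNIV_2)
  then have areaR: "measure lebesgue R = (h e + h (- e)) * (h f + h (- f))"
    by (simp add: R_def)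
  have Rm: "R \<in> lmeasurable" by (simp add: R_def)
  have Km: "K \<in> lmeasurable" using conv_spaceD(3)[OF K] by (rule lmeasurable_compact)
  define C where "C n = cut_off h n e f \<union> cut_off h n f (- e)
    \<union> cut_off h n (- e) (- f) \<union> cut_off h n (- f) e" for n
  have cut_m: "cut_off h n e f \<in> lmeasurable" "cut_off h n f (- e) \<in> lmeasurable"
    "cut_off h n (- e) (- f) \<in> lmeasurable" "cut_off h n (- f) e \<in> lmeasurable" for n
    by (intro measure_cut_off[THEN conjunct1]; simp add: comp)+
  have cut_area: "measure lebesgue (cut_off h n e f) = cut_off_form h h n e f"
    "measure lebesgue (cut_off h n f (- e)) = cut_off_form h h n f (- e)"
    "measure lebesgue (cut_off h n (- e) (- f)) = cut_off_form h h n (- e) (- f)"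
    "measure lebesgue (cut_off h n (- f) e) = cut_off_form h h n (- f) e" for n
    by (intro measure_cut_off[THEN conjunct2]; simp add: comp)+
  have Cm: "C n \<in> lmeasurable" for n
    unfolding C_def by (intro fmeasurable.Un cut_m)
  \<comment> \<open>Neighbouring quadrants share the normal \<open>u\<close>, and their outer
    normals sum to zero; hence the parameter \<open>e = 0\<close>.\<close>
  have adj: "cut_off h n a u \<inter> cut_off h n u (- a) = {}" for n a u
    by (rule cut_off_adjacent_disjoint[of 1 _ 1 _ 0]) auto
  have "measure lebesgue (C n) = cut_off_form h h n e f + cut_off_form h h n f (- e)
      + cut_off_form h h n (- e) (- f) + cut_off_form h h n (- f) e" for n
    unfolding C_def cut_area[symmetric]
  proof (rule measure_Un4_disjoint[OF cut_m])
    show "cut_off h n e f \<inter> cut_off h n f (- e) = {}" by (rule adj)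
    show "cut_off h n e f \<inter> cut_off h n (- e) (- f) = {}" by (rule cut_off_opposite_disjoint)
    show "cut_off h n e f \<inter> cut_off h n (- f) e = {}" using adj[of n "- f" e] by auto
    show "cut_off h n f (- e) \<inter> cut_off h n (- e) (- f) = {}" by (rule adj)
    show "cut_off h n f (- e) \<inter> cut_off h n (- f) e = {}"
      using cut_off_opposite_disjoint[of n f "- e" n] by simp
    show "cut_off h n (- e) (- f) \<inter> cut_off h n (- f) e = {}" using adj[of n "- e" "- f"] by simp
  qed
  then have form: "area_form h h n = measure lebesgue R - measure lebesgue (C n)" for n
    unfolding area_form_def Let_def e_def[symmetric] f_def[symmetric] areaR by simp
  have CR: "C n \<subseteq> R - K" for n
  proof
    fix x assume "x \<in> C n"
    then obtain a b where ab: "x \<in> cut_off h n a b"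
      "(a, b) \<in> {(e, f), (f, - e), (- e, - f), (- f, e)}"
      unfolding C_def by blast
    have "x \<in> R"
      using ab(2) cut_off_violated[OF ab(1)] cut_off_opposite_side[OF ab(1)] by (auto simp: R_iff)
    moreover have "x \<notin> K"
      using cut_off_violated[OF ab(1)] support_fun_upper[OF K, of x] by (auto simp: h_def not_less[symmetric])
    ultimately show "x \<in> R - K" by blast
  qed
  have RC: "R - K \<subseteq> (\<Union>n. C n)"
  proof
    fix x assume x: "x \<in> R - K"
    then obtain i j :: int where ij:
      "h (vector [of_int i, of_int j]) < vector [of_int i, of_int j] \<bullet> x"
      using separating_integer_direction[OF K, of x] unfolding h_def by blast
    obtain a b p q where ab: "(a, b) \<in> {(e, f), (f, - e), (- e, - f), (- f, e)}"
      and v: "vector [of_int i, of_int j] = real p *\<^sub>R a + real q *\<^sub>R b"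
      using integer_direction_quadrant[of i j] unfolding e_def f_def by blast
    have "a \<bullet> x \<le> h a" "b \<bullet> x \<le> h b" using ab x by (auto simp: R_iff)
    then obtain n where "x \<in> cut_off h n a b"
      using violated_imp_cut_off ij unfolding v by blast
    then have "x \<in> C n" using ab unfolding C_def by blast
    then show "x \<in> (\<Union>n. C n)" by blast
  qed
  have "(\<lambda>n. measure lebesgue (C n)) \<longlonglongrightarrow> measure lebesgue (\<Union>n. C n)"
  proof (rule measure_nested_Union[OF Cm])
    show "measure lebesgue (C n) \<le> measure lebesgue R" for n
      using CR[of n] Cm Rm by (intro measure_mono_fmeasurable) auto
    show "C n \<subseteq> C (Suc n)" for n
      unfolding C_def by (intro Un_mono cut_off_mono)
  qed
  moreover have "(\<Union>n. C n) = R - K" using CR RC by blast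
  moreover have "measure lebesgue (R - K) = measure lebesgue R - measure lebesgue K"
    using Rm Km KR by (simp add: measurable_measure_Diff)
  ultimately have "(\<lambda>n. measure lebesgue R - measure lebesgue (C n))
      \<longlonglongrightarrow> measure lebesgue R - (measure lebesgue R - measure lebesgue K)"
    by (intro tendsto_diff) auto
  moreover have "area_form h h = (\<lambda>n. measure lebesgue R - measure lebesgue (C n))"
    using form by (rule ext)
  ultimately show ?thesis by (simp add: h_def[symmetric])
qed

section \<open>Bilinearity of the area form and of mixed area\<close>

lemma cut_off_form_commute: "cut_off_form h k n a b = cut_off_form k h n a b"
  by (induction n arbitrary: a b) (simp_all add: mult.commute)

lemma cut_off_form_sum_left:
  "cut_off_form (\<lambda>u. \<Sum>i\<in>I. c i * h i u) k n a b = (\<Sum>i\<in>I. c i * cut_off_form (h i) k n a b)"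
  by (induction n arbitrary: a b)
    (simp_all add: sum.distrib sum_subtractf sum_distrib_left sum_divide_distrib algebra_simps
      add_divide_distrib diff_divide_distrib)

lemma area_form_commute: "area_form h k n = area_form k h n"
  by (simp add: area_form_def Let_def cut_off_form_commute[of h k] add.commute)

lemma area_form_sum_left:
  "area_form (\<lambda>u. \<Sum>i\<in>I. c i * h i u) k n = (\<Sum>i\<in>I. c i * area_form (h i) k n)"
  unfolding area_form_def Let_def cut_off_form_sum_left
  by (simp add: sum.distrib[symmetric] sum_subtractf[symmetric] sum_distrib_right sum_distrib_left
      sum_divide_distrib algebra_simps)

lemma area_form_sum:
  "area_form (\<lambda>u. \<Sum>i\<in>I. c i * h i u) (\<lambda>u. \<Sum>j\<in>J. d j * k j u) n
   = (\<Sum>i\<in>I. \<Sum>j\<in>J. c i * d j * area_form (h i) (k j) n)"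
  unfolding area_form_sum_left area_form_commute[of "h _" "\<lambda>u. \<Sum>j\<in>J. d j * k j u"]
  by (simp add: area_form_commute[of "k _"] sum_distrib_left mult.assoc)

text \<open>The two-term combination is an instance of the general sum with index type
  \<open>bool\<close>.\<close>

lemma area_form_lin2:
  "area_form (\<lambda>u. a * h u + b * k u) (\<lambda>u. a * h u + b * k u) n
   = a\<^sup>2 * area_form h h n + 2 * a * b * area_form h k n + b\<^sup>2 * area_form k k n"
  using area_form_sum[where I = "UNIV :: bool set" and J = "UNIV :: bool set"
      and c = "\<lambda>i. if i then a else b" and d = "\<lambda>i. if i then a else b"
      and h = "\<lambda>i. if i then h else k" and k = "\<lambda>i. if i then h else k" and n = n]
  by (simp add: UNIV_bool area_form_commute[of k h] power2_eq_square algebra_simps)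

text \<open>The value that Minkowski's identity forces on the mixed area at
  \<open>a = b = 1\<close>, written without a definite description.\<close>

definition polar_area :: "(real^2) set \<Rightarrow> (real^2) set \<Rightarrow> real" where
  "polar_area X Y = (measure lebesgue (X + Y) - measure lebesgue X - measure lebesgue Y) / 2"

lemma area_form_tendsto_polar:
  assumes "X \<in> conv_space" "Y \<in> conv_space"
  shows "area_form (support_fun X) (support_fun Y) \<longlonglongrightarrow> polar_area X Y"
proof -
  let ?h = "support_fun X" and ?k = "support_fun Y"
  have "support_fun (X + Y) = (\<lambda>u. 1 * ?h u + 1 * ?k u)"
    using support_fun_plus[OF assms] by auto
  then have "area_form ?h ?k n = (area_form (support_fun (X + Y)) (support_fun (X + Y)) n
      - area_form ?h ?h n - area_form ?k ?k n) / 2" for n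
    using area_form_lin2[of 1 ?h 1 ?k n] by simp
  then have "area_form ?h ?k = (\<lambda>n. (area_form (support_fun (X + Y)) (support_fun (X + Y)) n
      - area_form ?h ?h n - area_form ?k ?k n) / 2)" by (rule ext)
  also have "\<dots> \<longlonglongrightarrow> polar_area X Y"
    unfolding polar_area_def
    by (intro tendsto_divide tendsto_diff area_form_tendsto conv_space_plus assms tendsto_const) simp
  finally show ?thesis .
qed

text \<open>Existence of the coefficient is the limit of the quadratic expansion of the area forms;
  uniqueness already follows from \<open>a = b = 1\<close>.\<close>

lemma mixed_area_eq_polar:
  assumes "X \<in> conv_space" "Y \<in> conv_space"
  shows "mixed_area X Y = polar_area X Y"
  unfolding mixed_area_def
proof (rule the_equality)
  let ?h = "support_fun X" and ?k = "support_fun Y"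
  show "\<forall>a\<ge>0. \<forall>b\<ge>0. measure lebesgue ((*\<^sub>R) a ` X + (*\<^sub>R) b ` Y) =
      a\<^sup>2 * measure lebesgue X + 2 * a * b * polar_area X Y + b\<^sup>2 * measure lebesgue Y"
  proof (intro allI impI)
    fix a b :: real assume ab: "0 \<le> a" "0 \<le> b"
    let ?Z = "(*\<^sub>R) a ` X + (*\<^sub>R) b ` Y"
    have "support_fun ?Z = (\<lambda>u. a * ?h u + b * ?k u)"
      using assms ab by (simp add: fun_eq_iff support_fun_plus support_fun_scaleR_image conv_space_scaleR)
    then have "area_form (support_fun ?Z) (support_fun ?Z)
        = (\<lambda>n. a\<^sup>2 * area_form ?h ?h n + 2 * a * b * area_form ?h ?k n + b\<^sup>2 * area_form ?k ?k n)"
      by (intro ext) (simp only: area_form_lin2)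
    also have "\<dots> \<longlonglongrightarrow> a\<^sup>2 * measure lebesgue X + 2 * a * b * polar_area X Y + b\<^sup>2 * measure lebesgue Y"
      by (intro tendsto_add tendsto_mult_left area_form_tendsto area_form_tendsto_polar assms)
    finally show "measure lebesgue ?Z =
        a\<^sup>2 * measure lebesgue X + 2 * a * b * polar_area X Y + b\<^sup>2 * measure lebesgue Y"
      using area_form_tendsto[of ?Z] assms
      by (meson LIMSEQ_unique conv_space_plus conv_space_scaleR)
  qed
next
  fix s assume "\<forall>a\<ge>0. \<forall>b\<ge>0. measure lebesgue ((*\<^sub>R) a ` X + (*\<^sub>R) b ` Y) =
      a\<^sup>2 * measure lebesgue X + 2 * a * b * s + b\<^sup>2 * measure lebesgue Y"
  from this[rule_format, of 1 1] show "s = polar_area X Y" by (simp add: polar_area_def)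
qed

lemma mixed_area_commute:
  assumes "X \<in> conv_space" "Y \<in> conv_space"
  shows "mixed_area X Y = mixed_area Y X"
  using assms by (simp add: mixed_area_eq_polar polar_area_def add.commute)

lemma mixed_area_orthogonal_image:
  assumes "X \<in> conv_space" "Y \<in> conv_space" and A: "orthogonal_transformation A"
  shows "mixed_area (A ` X) (A ` Y) = mixed_area X Y"
proof -
  have lin: "linear A" using A by (rule orthogonal_transformation_linear)
  have m: "measure lebesgue (A ` Z) = measure lebesgue Z" if "Z \<in> conv_space" for Z
    using measure_orthogonal_image[OF A] that by (simp add: conv_spaceD lmeasurable_compact)
  have "A ` X + A ` Y = A ` (X + Y)"
    unfolding set_plus_image image_image
    by (force simp: linear_add[OF lin] set_plus_def)
  then show ?thesis
    using assms lin by (simp add: mixed_area_eq_polar conv_space_linear_image polar_area_def m conv_space_plus)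
qed

text \<open>Bilinearity holds exactly for every \<open>area_form\<close> and passes to the limit.
  Expanding support functions instead of sets allows coefficients of either sign.\<close>

lemma mixed_area_sum:
  assumes "X \<in> conv_space" "Y \<in> conv_space"
    "\<And>i. i \<in> I \<Longrightarrow> K i \<in> conv_space" "\<And>j. j \<in> J \<Longrightarrow> L j \<in> conv_space"
    and "\<And>u. support_fun X u = (\<Sum>i\<in>I. c i * support_fun (K i) u)"
    and "\<And>u. support_fun Y u = (\<Sum>j\<in>J. d j * support_fun (L j) u)"
  shows "mixed_area X Y = (\<Sum>i\<in>I. \<Sum>j\<in>J. c i * d j * mixed_area (K i) (L j))"
proof (rule LIMSEQ_unique)
  show "area_form (support_fun X) (support_fun Y) \<longlonglongrightarrow> mixed_area X Y"
    using assms by (simp add: mixed_area_eq_polar area_form_tendsto_polar)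
  have "support_fun X = (\<lambda>u. \<Sum>i\<in>I. c i * support_fun (K i) u)"
    "support_fun Y = (\<lambda>u. \<Sum>j\<in>J. d j * support_fun (L j) u)" using assms by auto
  then have "area_form (support_fun X) (support_fun Y)
      = (\<lambda>n. \<Sum>i\<in>I. \<Sum>j\<in>J. c i * d j * area_form (support_fun (K i)) (support_fun (L j)) n)"
    by (intro ext) (simp only: area_form_sum)
  also have "\<dots> \<longlonglongrightarrow> (\<Sum>i\<in>I. \<Sum>j\<in>J. c i * d j * mixed_area (K i) (L j))"
    by (intro tendsto_sum tendsto_mult_left)
      (use assms in \<open>simp add: mixed_area_eq_polar area_form_tendsto_polar\<close>)
  finally show "area_form (support_fun X) (support_fun Y)
      \<longlonglongrightarrow> (\<Sum>i\<in>I. \<Sum>j\<in>J. c i * d j * mixed_area (K i) (L j))" .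
qed

section \<open>The cyclic linear system\<close>

lemma sum_periodic_shift:
  fixes g :: "nat \<Rightarrow> 'a::comm_monoid_add"
  assumes "\<And>j. g (j + m) = g j"
  shows "(\<Sum>j<m. g (j + i)) = (\<Sum>j<m. g j)"
proof (induction i)
  case (Suc i)
  have "(\<Sum>j<m. g (Suc j + i)) = (\<Sum>j<m. g (j + i))"
  proof (cases m)
    case (Suc k)
    have "(\<Sum>j<Suc k. g (Suc j + i)) = (\<Sum>j<k. g (Suc j + i)) + g (i + m)"
      by (simp add: Suc add.commute)
    also have "\<dots> = g (0 + i) + (\<Sum>j<k. g (Suc j + i))"
      by (simp add: assms add.commute)
    also have "\<dots> = (\<Sum>j<Suc k. g (j + i))"
      by (simp only: sum.lessThan_Suc_shift)
    finally show ?thesis using Suc by simp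
  qed simp
  with Suc show ?case by simp
qed simp

lemma sum_periodic_reflect:
  fixes g :: "nat \<Rightarrow> 'a::comm_monoid_add"
  assumes "g m = g 0"
  shows "(\<Sum>q<m. g (m - q)) = (\<Sum>q<m. g q)"
proof (cases m)
  case (Suc k)
  have "(\<Sum>q<m. g (m - q)) = (\<Sum>q<m. g (Suc q))"
    unfolding sum.nat_diff_reindex[of "\<lambda>q. g (Suc q)" m, symmetric]
    by (intro sum.cong refl) (simp add: Suc_diff_Suc)
  also have "\<dots> = (\<Sum>q<m. g q)"
    using assms unfolding Suc
    by (subst sum.lessThan_Suc, subst sum.lessThan_Suc_shift) (simp add: add.commute)
  finally show ?thesis .
qed simp

text \<open>Pairing \<open>q\<close> with \<open>m - q\<close> leaves only the index 0
  unpaired.\<close>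

lemma sum_symmetric_odd:
  fixes g :: "nat \<Rightarrow> real"
  assumes "odd m" "\<And>q. q \<le> m \<Longrightarrow> g (m - q) = g q"
  shows "(\<Sum>q<m. g q) = g 0 + 2 * (\<Sum>q=1..m div 2. g q)"
proof -
  define k where "k = m div 2"
  have m: "m = 2 * k + 1" using assms(1) by (simp add: k_def)
  have "(\<Sum>q<m. g q) = g 0 + (\<Sum>q=1..2 * k. g q)"
    unfolding m Suc_eq_plus1[symmetric] by (simp only: sum.lessThan_Suc_shift sum.atLeast1_atMost_eq One_nat_def)
  also have "(\<Sum>q=1..2 * k. g q) = (\<Sum>q=1..k. g q) + (\<Sum>q=k+1..2 * k. g q)"
    using sum.ub_add_nat[of 1 k g k] by (simp add: mult_2)
  also have "(\<Sum>q=k+1..2 * k. g q) = (\<Sum>q=1..k. g (m - q))"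
    by (rule sum.reindex_bij_witness[of _ "\<lambda>q. m - q" "\<lambda>q. m - q"]) (auto simp: m)
  also have "\<dots> = (\<Sum>q=1..k. g q)"
    by (intro sum.cong refl assms(2)) (auto simp: m)
  finally show ?thesis by (simp add: k_def)
qed

text \<open>Here the pairing of \<open>q\<close> with \<open>m - q\<close> also fixes
  \<open>m div 2\<close>, which contributes a separate term.\<close>

lemma sum_symmetric_even:
  fixes g :: "nat \<Rightarrow> real"
  assumes "even m" "m > 0" "\<And>q. q \<le> m \<Longrightarrow> g (m - q) = g q"
  shows "(\<Sum>q<m. g q) = g 0 + g (m div 2) + 2 * (\<Sum>q=1..(m-2) div 2. g q)"
proof -
  define k where "k = (m - 2) div 2"
  have m: "m = 2 * k + 2" using assms(1,2) by (auto simp: k_def elim!: evenE)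
  have "m = Suc (2 * k + 1)" by (simp add: m)
  then have "(\<Sum>q<m. g q) = g 0 + (\<Sum>q=1..2 * k + 1. g q)"
    by (simp only: sum.lessThan_Suc_shift sum.atLeast1_atMost_eq One_nat_def)
  also have "(\<Sum>q=1..2 * k + 1. g q) = (\<Sum>q=1..k+1. g q) + (\<Sum>q=k+2..2 * k + 1. g q)"
    using sum.ub_add_nat[of 1 "k+1" g k] by (simp add: mult_2)
  also have "(\<Sum>q=k+2..2 * k + 1. g q) = (\<Sum>q=1..k. g (m - q))"
    by (rule sum.reindex_bij_witness[of _ "\<lambda>q. m - q" "\<lambda>q. m - q"]) (auto simp: m)
  also have "\<dots> = (\<Sum>q=1..k. g q)"
    by (intro sum.cong refl assms(3)) (auto simp: m)
  also have "(\<Sum>q=1..k+1. g q) = (\<Sum>q=1..k. g q) + g (m div 2)" by (simp add: m)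
  finally show ?thesis by (simp add: k_def)
qed

text \<open>For a natural number \<open>x < m\<close> this is \<open>\<Sum>\<^sub>k t\<^sup>k / k!\<close> over all \<open>k\<close> congruent to \<open>x\<close> modulo \<open>m\<close>.\<close>

definition cyclic_exp :: "nat \<Rightarrow> real \<Rightarrow> real \<Rightarrow> real" where
  "cyclic_exp m x t = (\<Sum>q<m. exp (t * cos (2*pi*real q / real m))
     * cos (t * sin (2*pi*real q / real m) - x * (2*pi*real q / real m))) / real m"

text \<open>Each summand is the real part of
  \<open>exp (t * cis \<theta>) * cis (- x * \<theta>)\<close>; differentiation multiplies by
  \<open>cis \<theta>\<close>, which lowers \<open>x\<close> by one. A real index avoids truncated
  subtraction at 0.\<close>

lemma cyclic_exp_has_derivative: "((\<lambda>t. cyclic_exp m x t) has_real_derivative cyclic_exp m (x - 1) t) (at t)"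
proof -
  have *: "((\<lambda>t. exp (t * cos \<theta>) * cos (t * sin \<theta> - x * \<theta>)) has_real_derivative
      exp (t * cos \<theta>) * cos (t * sin \<theta> - (x - 1) * \<theta>)) (at t)" for \<theta> :: real
  proof -
    have "cos (t * sin \<theta> - (x - 1) * \<theta>) = cos ((t * sin \<theta> - x * \<theta>) + \<theta>)"
      by (simp add: algebra_simps)
    then show ?thesis
      unfolding cos_add by (auto intro!: derivative_eq_intros simp: right_diff_distrib mult_ac)
  qed
  show ?thesis
    unfolding cyclic_exp_def by (intro DERIV_cdivide DERIV_sum *)
qed

lemma cyclic_exp_periodic:
  assumes "m > 0"
  shows "cyclic_exp m (x + real m) t = cyclic_exp m x t"
proof -
  have "cos (a - (x + real m) * (2*pi*real q / real m)) = cos (a - x * (2*pi*real q / real m))" for a q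
  proof -
    have "a - (x + real m) * (2*pi*real q / real m) = (a - x * (2*pi*real q / real m)) - 2 * real q * pi"
      using assms by (simp add: field_simps)
    then show ?thesis by (simp only: cos_diff[of _ "2 * real q * pi"] cos_2npi sin_2npi mult_1_right mult_zero_right add_0_right)
  qed
  then show ?thesis by (simp only: cyclic_exp_def)
qed

section \<open>Roots of unity and the autocorrelation of the coefficients\<close>

lemma sum_cis_multiples:
  fixes j :: int
  assumes "m > 0"
  shows "(\<Sum>q<m. cis (real q * (2*pi*real_of_int j / real m))) = (if int m dvd j then of_nat m else 0)"
proof -
  let ?w = "cis (2*pi*real_of_int j / real m)"
  have eq: "(\<Sum>q<m. cis (real q * (2*pi*real_of_int j / real m))) = (\<Sum>q<m. ?w ^ q)"
    by (rule sum.cong) (simp_all only: Complex.DeMoivre)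
  have one: "?w ^ m = 1"
    using assms by (simp add: Complex.DeMoivre)
  have w1: "?w = 1 \<longleftrightarrow> int m dvd j"
  proof
    assume "?w = 1"
    then have "cos (2*pi*real_of_int j / real m) = 1" by (simp add: complex_eq_iff)
    then obtain n :: int where "2*pi*real_of_int j / real m = of_int n * 2 * pi"
      by (auto simp: cos_one_2pi_int)
    then have "real_of_int j = of_int (n * int m)" using assms by (simp add: field_simps)
    then have "j = n * int m" by (simp only: of_int_eq_iff)
    then show "int m dvd j" by simp
  next
    assume "int m dvd j"
    then obtain n where "j = int m * n" by (auto simp: dvd_def)
    then have "2*pi*real_of_int j / real m = 2 * pi * of_int n" using assms by simp
    then show "?w = 1" by simp
  qed
  show ?thesis
  proof (cases "int m dvd j")
    case True
    then show ?thesis unfolding eq using w1 by simp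
  next
    case False
    then show ?thesis unfolding eq using w1 one by (simp add: geometric_sum)
  qed
qed

text \<open>Initial values of the fundamental solution: at \<open>t = 0\<close> only a sum of roots
  of unity remains.\<close>

lemma cyclic_exp_0:
  assumes "j < m"
  shows "cyclic_exp m (real j) 0 = (if j = 0 then 1 else 0)"
proof -
  have "cyclic_exp m (real j) 0 = Re (\<Sum>q<m. cis (real q * (2*pi*real_of_int (int j) / real m))) / real m"
    by (simp add: cyclic_exp_def mult_ac)
  also have "\<dots> = (if j = 0 then 1 else 0)"
    using assms by (subst sum_cis_multiples) (auto dest: zdvd_imp_le)
  finally show ?thesis .
qed

text \<open>The Fourier sum before taking real parts, in which products of coefficients separate
  into exponentials.\<close>

definition cyclic_exp_complex :: "nat \<Rightarrow> nat \<Rightarrow> real \<Rightarrow> complex" where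
  "cyclic_exp_complex m j t = (\<Sum>q<m. exp (complex_of_real t * cis (2*pi*real q / real m))
     * cis (- (real j * (2*pi*real q / real m)))) / of_nat m"

text \<open>Replacing \<open>q\<close> by \<open>m - q\<close> conjugates each summand, so the
  imaginary part of the sum vanishes.\<close>

lemma cyclic_exp_complex_eq:
  assumes "m > 0"
  shows "cyclic_exp_complex m j t = complex_of_real (cyclic_exp m (real j) t)"
proof (rule complex_eqI)
  show "Re (cyclic_exp_complex m j t) = Re (complex_of_real (cyclic_exp m (real j) t))"
    by (simp add: cyclic_exp_complex_def cyclic_exp_def exp_eq_polar cis_mult cos_diff cos_add
        algebra_simps)
  let ?g = "\<lambda>q. exp (complex_of_real t * cis (2*pi*real q / real m))
     * cis (- (real j * (2*pi*real q / real m)))"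
  have per: "cis (2*pi*real (m - q) / real m) = cis (- (2*pi*real q / real m))"
    "cis (- (real j * (2*pi*real (m - q) / real m))) = cis (real j * (2*pi*real q / real m))"
    if "q \<le> m" for q
  proof -
    have *: "2*pi*real (m - q) / real m = 2 * pi - 2*pi*real q / real m"
      using that assms by (simp add: of_nat_diff field_simps)
    show "cis (2*pi*real (m - q) / real m) = cis (- (2*pi*real q / real m))"
      unfolding * by (simp flip: cis_divide cis_inverse add: divide_inverse)
    have "- (real j * (2*pi*real (m - q) / real m)) = real j * (2*pi*real q / real m) - 2 * pi * real j"
      unfolding * by (simp add: algebra_simps)
    then show "cis (- (real j * (2*pi*real (m - q) / real m))) = cis (real j * (2*pi*real q / real m))"
      by (simp flip: cis_divide)
  qed
  have "cnj (\<Sum>q<m. ?g q) = (\<Sum>q<m. ?g (m - q))"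
    unfolding cnj_sum by (intro sum.cong refl) (use per in \<open>simp add: exp_cnj cis_cnj\<close>)
  also have "\<dots> = (\<Sum>q<m. ?g q)"
    using per[of 0] by (intro sum_periodic_reflect) simp
  finally have "Im (cnj (\<Sum>q<m. ?g q)) = Im (\<Sum>q<m. ?g q)" by (rule arg_cong)
  then have "Im (\<Sum>q<m. ?g q) = 0" by (simp only: cnj.sel)
  then show "Im (cyclic_exp_complex m j t) = Im (complex_of_real (cyclic_exp m (real j) t))"
    by (simp add: cyclic_exp_complex_def Im_divide_of_nat)
qed

text \<open>Parseval's argument: after expanding both factors, summation over \<open>i\<close>
  annihilates all frequency pairs except \<open>q = r\<close>, and the squared modulus of
  \<open>E q\<close> is \<open>exp (2*t * cos (\<theta> q))\<close>.\<close>

lemma cyclic_exp_correlation: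
  assumes m: "m > 0"
  shows "(\<Sum>i<m. cyclic_exp m (real i) t * cyclic_exp m (real (i + p)) t)
    = (\<Sum>q<m. exp (2*t * cos (2*pi*real q / real m)) * cos (2*pi*real p*real q / real m)) / real m"
proof -
  define \<theta> where "\<theta> q = 2*pi*real q / real m" for q :: nat
  define E where "E q = exp (complex_of_real t * cis (\<theta> q))" for q
  have cc: "cyclic_exp_complex m j t = (\<Sum>q<m. E q * cis (- (real j * \<theta> q))) / of_nat m" for j
    by (simp add: cyclic_exp_complex_def E_def \<theta>_def)
  \<comment> \<open>The values are real, so one factor may be conjugated; this turns the frequencies
    in \<open>i\<close> into the difference \<open>\<theta> q - \<theta> r\<close>.\<close>
  have "cnj (cyclic_exp_complex m i t) = cyclic_exp_complex m i t" for i by (simp add: cyclic_exp_complex_eq[OF m])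
  then have "complex_of_real (\<Sum>i<m. cyclic_exp m (real i) t * cyclic_exp m (real (i + p)) t)
      = (\<Sum>i<m. cnj (cyclic_exp_complex m i t) * cyclic_exp_complex m (i + p) t)"
    by (simp add: cyclic_exp_complex_eq[OF m])
  also have "\<dots> = (\<Sum>i<m. \<Sum>q<m. \<Sum>r<m. cnj (E q) * E r * cis (- (real p * \<theta> r))
      * cis (real i * (\<theta> q - \<theta> r))) / (of_nat m)\<^sup>2"
  proof -
    have "cnj (cyclic_exp_complex m i t) * cyclic_exp_complex m (i + p) t
      = (\<Sum>q<m. \<Sum>r<m. cnj (E q) * E r * cis (- (real p * \<theta> r))
      * cis (real i * (\<theta> q - \<theta> r))) / (of_nat m)\<^sup>2" for i
    proof -
      have "cis (real i * \<theta> q) * cis (- (real (i + p) * \<theta> r))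
          = cis (- (real p * \<theta> r)) * cis (real i * (\<theta> q - \<theta> r))" for q r
        by (simp add: cis_mult algebra_simps)
      then have *: "(cnj (E q) * cis (real i * \<theta> q)) * (E r * cis (- (real (i + p) * \<theta> r)))
          = cnj (E q) * E r * cis (- (real p * \<theta> r)) * cis (real i * (\<theta> q - \<theta> r))" for q r
        by (simp add: mult_ac)
      show ?thesis
        unfolding cc by (simp add: cis_cnj sum_product * power2_eq_square del: of_nat_add)
    qed
    then show ?thesis by (simp add: sum_divide_distrib)
  qed
  also have "(\<Sum>i<m. \<Sum>q<m. \<Sum>r<m. cnj (E q) * E r * cis (- (real p * \<theta> r))
      * cis (real i * (\<theta> q - \<theta> r)))
     = (\<Sum>q<m. \<Sum>r<m. \<Sum>i<m. cnj (E q) * E r * cis (- (real p * \<theta> r))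
      * cis (real i * (\<theta> q - \<theta> r)))"
    by (subst sum.swap) (intro sum.cong refl sum.swap)
  also have "\<dots> = (\<Sum>q<m. \<Sum>r<m. if r = q then cnj (E q) * E q * cis (- (real p * \<theta> q)) * of_nat m else 0)"
  proof (intro sum.cong refl)
    fix q r assume qr: "q \<in> {..<m}" "r \<in> {..<m}"
    have dvd: "int m dvd (int q - int r) \<longleftrightarrow> r = q"
    proof
      assume "int m dvd (int q - int r)"
      then show "r = q"
        using qr zdvd_imp_le[of "int m" "\<bar>int q - int r\<bar>"] by (cases "r = q") auto
    qed simp
    have "\<theta> q - \<theta> r = 2*pi*real_of_int (int q - int r) / real m"
      by (simp add: \<theta>_def diff_divide_distrib algebra_simps)
    then have "(\<Sum>i<m. cis (real i * (\<theta> q - \<theta> r))) = (if r = q then of_nat m else 0)"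
      using sum_cis_multiples[OF m, of "int q - int r"] dvd by simp
    then show "(\<Sum>i<m. cnj (E q) * E r * cis (- (real p * \<theta> r)) * cis (real i * (\<theta> q - \<theta> r)))
      = (if r = q then cnj (E q) * E q * cis (- (real p * \<theta> q)) * of_nat m else 0)"
      by (simp flip: sum_distrib_left)
  qed
  also have "\<dots> = (\<Sum>q<m. complex_of_real (exp (2*t * cos (\<theta> q))) * cis (- (real p * \<theta> q))) * of_nat m"
  proof -
    have "cnj (E q) * E q = complex_of_real (exp (2*t * cos (\<theta> q)))" for q
    proof -
      have "cnj (E q) * E q = exp (complex_of_real t * (cnj (cis (\<theta> q)) + cis (\<theta> q)))"
        by (simp add: E_def exp_cnj exp_add[symmetric] algebra_simps)
      also have "cnj (cis (\<theta> q)) + cis (\<theta> q) = complex_of_real (2 * cos (\<theta> q))"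
        by (simp add: complex_eq_iff)
      finally show ?thesis by (simp add: exp_of_real[symmetric] mult_ac)
    qed
    then show ?thesis by (simp add: sum_distrib_right)
  qed
  finally have "complex_of_real (\<Sum>i<m. cyclic_exp m (real i) t * cyclic_exp m (real (i + p)) t)
    = (\<Sum>q<m. complex_of_real (exp (2*t * cos (\<theta> q))) * cis (- (real p * \<theta> q))) / of_nat m"
    using m by (simp add: power2_eq_square)
  then have "Re (complex_of_real (\<Sum>i<m. cyclic_exp m (real i) t * cyclic_exp m (real (i + p)) t))
    = Re ((\<Sum>q<m. complex_of_real (exp (2*t * cos (\<theta> q))) * cis (- (real p * \<theta> q))) / of_nat m)"
    by (rule arg_cong)
  then show ?thesis by (simp add: Re_divide_of_nat \<theta>_def mult_ac)
qed

text \<open>Duality in place of a uniqueness theorem: pairing \<open>f j s\<close> with the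
  fundamental solution at time \<open>t - s\<close> gives a function \<open>F\<close> constant in
  \<open>s\<close>, which is \<open>f 0 t\<close> at \<open>s = t\<close> and the claimed sum at
  \<open>s = 0\<close>.\<close>

lemma cyclic_system_solution:
  fixes f :: "nat \<Rightarrow> real \<Rightarrow> real"
  assumes m: "m > 0" and per: "\<And>s. f m s = f 0 s" and t: "t \<ge> 0"
    and der: "\<And>j s. s \<ge> 0 \<Longrightarrow> (f j has_real_derivative f (Suc j) s) (at s within {0..})"
  shows "f 0 t = (\<Sum>j<m. cyclic_exp m (real j) t * f j 0)"
proof -
  define F where "F s = (\<Sum>j<m. cyclic_exp m (real j) (t - s) * f j s)" for s
  have "(F has_real_derivative 0) (at s within {0..t})" if s: "s \<in> {0..t}" for s
  proof -
    have c: "((\<lambda>s. cyclic_exp m x (t - s)) has_real_derivative - cyclic_exp m (x - 1) (t - s)) (at s within {0..t})" for x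
      by (rule DERIV_cong[OF DERIV_chain2[where f = "cyclic_exp m x" and g = "\<lambda>s. t - s" and x = s and Db = "-1",
            OF cyclic_exp_has_derivative]]) (auto intro!: derivative_eq_intros)
    have f: "(f j has_real_derivative f (Suc j) s) (at s within {0..t})" for j
      using der s by (intro DERIV_subset[OF der]) auto
    have "(F has_real_derivative (\<Sum>j<m. - cyclic_exp m (real j - 1) (t - s) * f j s
        + f (Suc j) s * cyclic_exp m (real j) (t - s))) (at s within {0..t})"
      unfolding F_def by (intro DERIV_sum DERIV_mult c f)
    \<comment> \<open>Writing the index \<open>j\<close> as \<open>Suc j - 1\<close> exhibits
      consecutive differences of one sequence.\<close>
    also have "(\<Sum>j<m. - cyclic_exp m (real j - 1) (t - s) * f j s + f (Suc j) s * cyclic_exp m (real j) (t - s))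
        = (\<Sum>j<m. cyclic_exp m (real (Suc j) - 1) (t - s) * f (Suc j) s - cyclic_exp m (real j - 1) (t - s) * f j s)"
      by (intro sum.cong refl) (simp add: algebra_simps)
    also have "\<dots> = cyclic_exp m (real m - 1) (t - s) * f m s - cyclic_exp m (real 0 - 1) (t - s) * f 0 s"
      by (rule sum_lessThan_telescope)
    also have "\<dots> = 0"
      \<comment> \<open>The boundary terms carry the indices \<open>m - 1\<close> and
        \<open>- 1\<close> and cancel because both factors are periodic.\<close>
      using cyclic_exp_periodic[OF m, of "-1" "t - s"] per by simp
    finally show ?thesis .
  qed
  then obtain c where "\<And>s. s \<in> {0..t} \<Longrightarrow> F s = c"
    using has_field_derivative_zero_constant[of "{0..t}" F] by auto
  then have "F t = F 0" using t by simp
  moreover have "F t = f 0 t"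
  proof -
    have "F t = (\<Sum>j<m. if j = 0 then f j t else 0)"
      unfolding F_def by (intro sum.cong refl) (simp add: cyclic_exp_0)
    then show ?thesis using m by simp
  qed
  ultimately show ?thesis by (simp add: F_def)
qed

section \<open>Mixed area along solutions\<close>

text \<open>\<open>A ^^ m = id\<close> closes the chain of derivatives into a cycle of length
  \<open>m\<close>.\<close>

lemma support_fun_solution:
  fixes A :: "'a::euclidean_space \<Rightarrow> 'a"
  assumes "hukuhara_solution A X0 X" "linear A" "A ^^ m = id" "m > 0" "t \<ge> 0"
  shows "support_fun (X t) u = (\<Sum>j<m. cyclic_exp m (real j) t * support_fun ((A ^^ j) ` X0) u)"
  using cyclic_system_solution[of m "\<lambda>j s. support_fun ((A ^^ j) ` X s) u" t]
    support_fun_solution_derivative[OF assms(1,2)] assms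
  by (simp add: hukuhara_solution_def)

lemma orthogonal_transformation_funpow:
  fixes f :: "'a::euclidean_space \<Rightarrow> 'a"
  assumes "orthogonal_transformation f"
  shows "orthogonal_transformation (f ^^ n)"
  using assms
proof (induction n)
  case 0
  then show ?case by (simp add: orthogonal_transformation_def linear_iff)
next
  case (Suc n)
  then show ?case by (simp add: orthogonal_transformation_def linear_compose[unfolded o_def])
qed

text \<open>Invariance under \<open>A ^^ i\<close> makes each mixed area depend only on the
  difference \<open>p\<close> of the two exponents, so the double sum collects into autocorrelations
  of the coefficients.\<close>

lemma mixed_area_solutions:
  fixes A :: "real^2 \<Rightarrow> real^2"
  assumes A: "orthogonal_transformation A" and m: "m > 0" "A ^^ m = id"
    and X0: "X0 \<in> conv_space" and Y0: "Y0 \<in> conv_space"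
    and X: "hukuhara_solution A X0 X" and Y: "hukuhara_solution A Y0 Y" and t: "t \<ge> 0"
  shows "mixed_area (X t) (Y t) = (\<Sum>p<m. (\<Sum>q<m. exp (2*t * cos (2*pi*real q / real m))
    * cos (2*pi*real p*real q / real m)) / real m * mixed_area X0 ((A ^^ p) ` Y0))"
proof -
  have lin: "linear A" using A by (rule orthogonal_transformation_linear)
  have conv: "(A ^^ j) ` Z \<in> conv_space" if "Z \<in> conv_space" for j Z
    using conv_space_linear_image[OF that linear_funpow[OF lin]] .
  define c where "c j = cyclic_exp m (real j) t" for j
  define \<sigma> where "\<sigma> p = mixed_area X0 ((A ^^ p) ` Y0)" for p
  have per: "A ^^ (j + m) = A ^^ j" for j by (simp add: funpow_add m)
  have inner: "(\<Sum>j<m. c j * mixed_area ((A ^^ i) ` X0) ((A ^^ j) ` Y0)) = (\<Sum>p<m. c (i + p) * \<sigma> p)" for i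
  proof -
    have "c (j + m) = c j" for j using cyclic_exp_periodic[OF m(1), of "real j" t] by (simp add: c_def)
    \<comment> \<open>Substitutes \<open>j = p + i\<close> modulo \<open>m\<close>; both the
      coefficients and the powers of \<open>A\<close> are periodic.\<close>
    then have "(\<Sum>j<m. c j * mixed_area ((A ^^ i) ` X0) ((A ^^ j) ` Y0))
        = (\<Sum>p<m. c (p + i) * mixed_area ((A ^^ i) ` X0) ((A ^^ (p + i)) ` Y0))"
      by (intro sum_periodic_shift[symmetric]) (simp add: per)
    also have "\<dots> = (\<Sum>p<m. c (i + p) * \<sigma> p)"
    proof (intro sum.cong refl)
      fix p
      have "(A ^^ (p + i)) ` Y0 = (A ^^ i) ` (A ^^ p) ` Y0"
        by (simp only: image_comp funpow_add[symmetric] add.commute)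
      then show "c (p + i) * mixed_area ((A ^^ i) ` X0) ((A ^^ (p + i)) ` Y0) = c (i + p) * \<sigma> p"
        using mixed_area_orthogonal_image[OF X0 conv[OF Y0] orthogonal_transformation_funpow[OF A]]
        by (simp add: \<sigma>_def add.commute)
    qed
    finally show ?thesis .
  qed
  have "mixed_area (X t) (Y t)
      = (\<Sum>i<m. \<Sum>j<m. c i * c j * mixed_area ((A ^^ i) ` X0) ((A ^^ j) ` Y0))"
  proof (rule mixed_area_sum)
    show "X t \<in> conv_space" "Y t \<in> conv_space" using X Y t by (auto simp: hukuhara_solution_def)
  qed (simp_all add: conv X0 Y0 c_def support_fun_solution[OF X lin m(2,1) t]
      support_fun_solution[OF Y lin m(2,1) t])
  also have "\<dots> = (\<Sum>i<m. c i * (\<Sum>p<m. c (i + p) * \<sigma> p))"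
    unfolding inner[symmetric] by (simp add: sum_distrib_left mult.assoc)
  also have "\<dots> = (\<Sum>p<m. (\<Sum>i<m. c i * c (i + p)) * \<sigma> p)"
    unfolding sum_distrib_left sum_distrib_right by (subst sum.swap) (simp add: mult.assoc)
  also have "\<dots> = (\<Sum>p<m. (\<Sum>q<m. exp (2*t * cos (2*pi*real q / real m))
      * cos (2*pi*real p*real q / real m)) / real m * \<sigma> p)"
    unfolding c_def cyclic_exp_correlation[OF m(1)] ..
  finally show ?thesis unfolding \<sigma>_def .
qed

text \<open>Applying \<open>A ^^ p\<close> to both bodies on the right undoes
  \<open>A ^^ (m - p)\<close>; symmetry of mixed area does the rest.\<close>

lemma mixed_area_funpow_reflect:
  fixes A :: "real^2 \<Rightarrow> real^2"
  assumes A: "orthogonal_transformation A" and m: "A ^^ m = id" "p \<le> m"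
    and X0: "X0 \<in> conv_space" and Y0: "Y0 \<in> conv_space"
  shows "mixed_area Y0 ((A ^^ p) ` X0) = mixed_area X0 ((A ^^ (m - p)) ` Y0)"
proof -
  have conv: "(A ^^ j) ` Z \<in> conv_space" if "Z \<in> conv_space" for j Z
    using conv_space_linear_image[OF that linear_funpow[OF orthogonal_transformation_linear[OF A]]] .
  have "(A ^^ p) ` (A ^^ (m - p)) ` Y0 = Y0"
    using m by (simp add: image_comp flip: funpow_add)
  then show ?thesis
    using mixed_area_orthogonal_image[OF X0 conv[OF Y0] orthogonal_transformation_funpow[OF A], of p "m - p"]
      mixed_area_commute[OF Y0 conv[OF X0]] by simp
qed

lemma trig_complement:
  assumes "m > 0" "p \<le> m"
  shows "cos (2*pi*real (m - p)*real q / real m) = cos (2*pi*real p*real q / real m)"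
    and "sin (2*pi*real (m - p)*real q / real m) = - sin (2*pi*real p*real q / real m)"
proof -
  have *: "2*pi*real (m - p)*real q / real m = 2 * real q * pi - 2*pi*real p*real q / real m"
    using assms by (simp add: of_nat_diff field_simps)
  show "cos (2*pi*real (m - p)*real q / real m) = cos (2*pi*real p*real q / real m)"
    "sin (2*pi*real (m - p)*real q / real m) = - sin (2*pi*real p*real q / real m)"
    unfolding * by (simp_all only: cos_diff sin_diff cos_2npi sin_2npi)
qed

text \<open>The terms with factor \<open>t\<close> are odd under \<open>p \<mapsto> m - p\<close> and cancel; the weights
  \<open>m - p\<close> and \<open>p\<close> add up to \<open>m\<close>.\<close>

lemma reflected_sum:
  fixes \<sigma> :: "nat \<Rightarrow> real" and E :: "nat \<Rightarrow> real" and t :: real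
  assumes m: "m > 0"
  defines "G \<equiv> \<lambda>p. \<Sum>q<m. ((real m - real p) * cos (2*pi*real p*real q / real m)
      + 2*t * sin (2*pi*real p*real q / real m) * sin (2*pi*real q / real m)) * E q"
  shows "(\<Sum>p<m. (\<Sum>q<m. E q * cos (2*pi*real p*real q / real m)) / real m * \<sigma> p)
    = 1 / real m * (\<Sum>q<m. E q) * \<sigma> 0 + 1 / (real m)\<^sup>2 * (\<Sum>p=1..m-1. G p * (\<sigma> p + \<sigma> (m - p)))"
proof -
  define R where "R p = (\<Sum>q<m. E q * cos (2*pi*real p*real q / real m))" for p
  have GR: "G p + G (m - p) = real m * R p" if "p \<le> m" for p
    unfolding G_def R_def sum.distrib[symmetric] sum_distrib_left trig_complement[OF m that]
    by (intro sum.cong refl) (use that in \<open>simp add: of_nat_diff algebra_simps\<close>)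
  have "(\<Sum>p=1..m-1. G p * (\<sigma> p + \<sigma> (m - p))) = (\<Sum>p=1..m-1. G p * \<sigma> p) + (\<Sum>p=1..m-1. G p * \<sigma> (m - p))"
    by (simp add: distrib_left sum.distrib)
  \<comment> \<open>The reflection moves from \<open>\<sigma>\<close> to the weight, so that
    \<open>GR\<close> applies.\<close>
  also have "(\<Sum>p=1..m-1. G p * \<sigma> (m - p)) = (\<Sum>p=1..m-1. G (m - p) * \<sigma> p)"
    by (rule sum.reindex_bij_witness[of _ "\<lambda>p. m - p" "\<lambda>p. m - p"]) auto
  also have "(\<Sum>p=1..m-1. G p * \<sigma> p) + (\<Sum>p=1..m-1. G (m - p) * \<sigma> p) = (\<Sum>p=1..m-1. real m * R p * \<sigma> p)"
    unfolding sum.distrib[symmetric] distrib_right[symmetric]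
    by (intro sum.cong refl arg_cong2[where f = "(*)"] GR) auto
  finally have G: "1 / (real m)\<^sup>2 * (\<Sum>p=1..m-1. G p * (\<sigma> p + \<sigma> (m - p))) = (\<Sum>p=1..m-1. R p / real m * \<sigma> p)"
    using m by (simp add: sum_distrib_left power2_eq_square)
  have "m = Suc (m - 1)" using m by simp
  then have "(\<Sum>p<m. R p / real m * \<sigma> p) = R 0 / real m * \<sigma> 0 + (\<Sum>p=1..m-1. R p / real m * \<sigma> p)"
    by (metis (no_types, lifting) One_nat_def sum.atLeast1_atMost_eq sum.lessThan_Suc_shift)
  then show ?thesis unfolding G by (simp add: R_def)
qed

text \<open>Both sines change sign and the cosines do not, so the sum over \<open>q\<close> may be
  folded.\<close>

lemma cyclic_weight_symmetric:
  assumes "m > 0" "q \<le> m"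
  shows "(a * cos (2*pi*real p*real (m - q) / real m)
      + 2*t * sin (2*pi*real p*real (m - q) / real m) * sin (2*pi*real (m - q) / real m))
      * exp (2*t * cos (2*pi*real (m - q) / real m))
    = (a * cos (2*pi*real p*real q / real m)
      + 2*t * sin (2*pi*real p*real q / real m) * sin (2*pi*real q / real m))
      * exp (2*t * cos (2*pi*real q / real m))"
  using trig_complement[OF assms, of p] trig_complement[OF assms, of 1] by (simp add: mult_ac)

theorem lemma3p4:
  fixes A :: "real^2 \<Rightarrow> real^2" and m :: nat
    and X0 Xs0 :: "(real^2) set" and X Xs :: "real \<Rightarrow> (real^2) set"
  assumes "orthogonal_transformation A"
    and "m > 0" and "A ^^ m = id"
    and "X0 \<in> convex_bodies" and "Xs0 \<in> convex_bodies"
    and "hukuhara_solution A X0 X" and "hukuhara_solution A Xs0 Xs"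
  shows "\<forall>t\<ge>0.
    (m \<ge> 3 \<and> odd m \<longrightarrow>
      mixed_area (X t) (Xs t) =
        1 / real m * (exp (2*t) + 2 * (\<Sum>q=1..m div 2. exp (2*t * cos (2*pi*real q / real m))))
          * mixed_area X0 Xs0
        + 1 / (real m)\<^sup>2 * (\<Sum>p=1..m-1.
            ((real m - real p) * exp (2*t)
              + 2 * (\<Sum>q=1..m div 2.
                  ((real m - real p) * cos (2*pi*real p*real q / real m)
                    + 2*t * sin (2*pi*real p*real q / real m) * sin (2*pi*real q / real m))
                  * exp (2*t * cos (2*pi*real q / real m))))
            * (mixed_area X0 ((A ^^ p) ` Xs0) + mixed_area Xs0 ((A ^^ p) ` X0)))) \<and>
    (m \<ge> 4 \<and> even m \<longrightarrow>
      mixed_area (X t) (Xs t) =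
        1 / real m * (exp (2*t) + exp (- 2*t)
            + 2 * (\<Sum>q=1..(m-2) div 2. exp (2*t * cos (2*pi*real q / real m))))
          * mixed_area X0 Xs0
        + 1 / (real m)\<^sup>2 * (\<Sum>p=1..m-1.
            ((real m - real p) * (exp (2*t) + (-1)^p * exp (- 2*t))
              + 2 * (\<Sum>q=1..(m-2) div 2.
                  ((real m - real p) * cos (2*pi*real p*real q / real m)
                    + 2*t * sin (2*pi*real p*real q / real m) * sin (2*pi*real q / real m))
                  * exp (2*t * cos (2*pi*real q / real m))))
            * (mixed_area X0 ((A ^^ p) ` Xs0) + mixed_area Xs0 ((A ^^ p) ` X0))))"
    (is "\<forall>t\<ge>0. ?P t")
proof (intro allI impI)
  fix t :: real assume t: "t \<ge> 0"
  note m = \<open>m > 0\<close>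
  have X0: "X0 \<in> conv_space" and Xs0: "Xs0 \<in> conv_space"
    using assms by (simp_all add: convex_bodies_def)
  define E where "E q = exp (2*t * cos (2*pi*real q / real m))" for q :: nat
  define g where "g p q = ((real m - real p) * cos (2*pi*real p*real q / real m)
    + 2*t * sin (2*pi*real p*real q / real m) * sin (2*pi*real q / real m)) * E q" for p q :: nat
  define \<sigma> where "\<sigma> p = mixed_area X0 ((A ^^ p) ` Xs0)" for p
  have \<sigma>: "\<sigma> 0 = mixed_area X0 Xs0" by (simp add: \<sigma>_def)
  have \<sigma>': "mixed_area Xs0 ((A ^^ p) ` X0) = \<sigma> (m - p)" if "p \<in> {1..m-1}" for p
    unfolding \<sigma>_def using that
    by (intro mixed_area_funpow_reflect[OF assms(1) assms(3) _ X0 Xs0]) auto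
  \<comment> \<open>Formula common to both parities; the two cases differ only in how the sums over
    \<open>q\<close> fold.\<close>
  have main: "mixed_area (X t) (Xs t) = 1 / real m * (\<Sum>q<m. E q) * \<sigma> 0
      + 1 / (real m)\<^sup>2 * (\<Sum>p=1..m-1. (\<Sum>q<m. g p q) * (\<sigma> p + \<sigma> (m - p)))"
    using mixed_area_solutions[OF assms(1-3) X0 Xs0 assms(6,7) t] reflected_sum[OF m, of E \<sigma> t]
    unfolding g_def E_def \<sigma>_def by simp
  have symE: "E (m - q) = E q" if "q \<le> m" for q
    using trig_complement(1)[OF m that, of 1] by (simp add: E_def)
  have symg: "g p (m - q) = g p q" if "q \<le> m" for p q
    using cyclic_weight_symmetric[OF m that] unfolding g_def E_def by blast
  have E0: "E 0 = exp (2*t)" by (simp add: E_def)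
  have g0: "g p 0 = (real m - real p) * exp (2*t)" for p by (simp add: g_def E_def)
  have cong: "(\<Sum>p=1..m-1. f p * (\<sigma> p + \<sigma> (m - p)))
      = (\<Sum>p=1..m-1. f p * (mixed_area X0 ((A ^^ p) ` Xs0) + mixed_area Xs0 ((A ^^ p) ` X0)))" for f
    by (intro sum.cong refl) (simp add: \<sigma>' \<sigma>_def)
  have odd: "mixed_area (X t) (Xs t) =
      1 / real m * (exp (2*t) + 2 * (\<Sum>q=1..m div 2. E q)) * \<sigma> 0
      + 1 / (real m)\<^sup>2 * (\<Sum>p=1..m-1. ((real m - real p) * exp (2*t)
        + 2 * (\<Sum>q=1..m div 2. g p q)) * (\<sigma> p + \<sigma> (m - p)))" if "odd m"
    using main sum_symmetric_odd[where g = E, OF that symE]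
      sum_symmetric_odd[where g = "g p" for p, OF that symg] by (simp only: E0 g0)
  have even: "mixed_area (X t) (Xs t) =
      1 / real m * (exp (2*t) + exp (- 2*t) + 2 * (\<Sum>q=1..(m-2) div 2. E q)) * \<sigma> 0
      + 1 / (real m)\<^sup>2 * (\<Sum>p=1..m-1. ((real m - real p) * (exp (2*t) + (-1)^p * exp (- 2*t))
        + 2 * (\<Sum>q=1..(m-2) div 2. g p q)) * (\<sigma> p + \<sigma> (m - p)))" if "even m"
  proof -
    \<comment> \<open>At \<open>q = m div 2\<close> the angle is \<open>pi\<close>: the exponential
      becomes \<open>exp (- 2*t)\<close>, the sine term vanishes, and the cosine gives the sign
      \<open>(-1)^p\<close>.\<close>
    have half: "real (m div 2) = real m / 2" using that by (simp add: real_of_nat_div)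
    have Eh: "E (m div 2) = exp (- 2*t)" using m by (simp add: E_def half)
    have gh: "g p (m div 2) = (real m - real p) * ((-1)^p * exp (- 2*t))" for p
      using m unfolding g_def Eh half
      by (simp add: mult.commute[of pi] cos_npi sin_npi)
    show ?thesis
      using main sum_symmetric_even[where g = E, OF that m symE]
        sum_symmetric_even[where g = "g p" for p, OF that m symg]
      by (simp only: E0 g0 Eh gh distrib_left)
  qed
  show "?P t"
    using odd even unfolding cong \<sigma> g_def E_def by blast
qed

end
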